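(* For $i=1,2$ let $G_i$ be a connected $r_i$-regular graph with $p_i$ vertices and $q_i$ edges, where $G_1$ is triangle-free. Let $r_1,\lambda_2,\ldots,\lambda_{p_1}$ and $r_2,\beta_2,\ldots,\beta_{p_2}$ be the adjacency eigenvalues of $G_1$ and $G_2$ respectively. Then the eigenvalues of $\epsilon(C[G_1]\dot{\vee}G_2)$, counted with multiplicity, are: (1) $3$ with multiplicity $q_1-p_1$; (2) $-2(1+\beta_j)$ for $j=2,\ldots,p_2$; (3) $-(2t_1+3(\lambda_i+r_1-1))$ for $i=2,\ldots,p_1$, where $t_1=\frac{-(3(r_1-1)+5\lambda_i)+\sqrt{(3(r_1-1)+5\lambda_i)^2+16(\lambda_i+r_1)}}{4}$; (4) $-(2t_2+3(\lambda_i+r_1-1))$ for $i=2,\ldots,p_1$, where $t_2=\frac{-(3(r_1-1)+5\lambda_i)-\sqrt{(3(r_1-1)+5\lambda_i)^2+16(\lambda_i+r_1)}}{4}$; (5) the three eigenvalues of the matrix $\begin{pmatrix}2r_1&2(q_1-r_1)&0\\2(p_1-2)&3(q_1-2r_1+1)&2p_2\\0&2q_1&2(p_2-1-r_2)\end{pmatrix}$.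
   Context: All graphs are finite, simple, undirected and connected. For a connected graph $H$ with vertices $v_1,\ldots,v_n$, $d(v_i,v_j)$ is the distance and $e(v_i)=\max_j d(v_i,v_j)$ the eccentricity. The eccentricity matrix $\epsilon(H)$ has $(i,j)$ entry $d(v_i,v_j)$ if $d(v_i,v_j)=\min\{e(v_i),e(v_j)\}$ and $0$ otherwise. The central graph $C[G]$ has vertex set $V(G)\cup I(G)$, where $I(G)=\{w_e:e\in E(G)\}$; its edges are $uw_e$ for each edge $e$ and each endpoint $u$ of $e$, and $uv$ for all distinct $u,v\in V(G)$ nonadjacent in $G$ (original edges of $G$ are not kept). The central vertex join $C[G_1]\dot{\vee}G_2$ is obtained from the disjoint union of $C[G_1]$ and $G_2$ by joining every vertex of $V(G_1)$ to every vertex of $G_2$.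
   Formalization: The formal statement assumes p_1 >= 2, excluding G_1 = K_1, where the multiplicity q_1 - p_1 is -1 and the list is false; for q_1 < p_1 (only G_1 = K_2) the negative multiplicity is read as signed: the spectrum plus p_1 - q_1 copies of 3 equals the rest of the list. *)

theory Defs
  imports
    "Jordan_Normal_Form.Char_Poly"
    "HOL-Computational_Algebra.Polynomial"
    "HOL-Library.Multiset"
begin

record 'a ugraph =
  verts :: "'a set"
  edges :: "'a set set"

definition simple_graph :: "'a ugraph \<Rightarrow> bool" where
  "simple_graph G \<longleftrightarrow> finite (verts G) \<and> (\<forall>e\<in>edges G. e \<subseteq> verts G \<and> card e = 2)"

definition adjacent :: "'a ugraph \<Rightarrow> 'a \<Rightarrow> 'a \<Rightarrow> bool" where
  "adjacent G u v \<longleftrightarrow> {u, v} \<in> edges G"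

definition walk_betw :: "'a ugraph \<Rightarrow> 'a \<Rightarrow> 'a list \<Rightarrow> 'a \<Rightarrow> bool" where
  "walk_betw G u xs v \<longleftrightarrow>
     xs \<noteq> [] \<and> hd xs = u \<and> last xs = v \<and> set xs \<subseteq> verts G \<and> successively (adjacent G) xs"

definition connected_graph :: "'a ugraph \<Rightarrow> bool" where
  "connected_graph G \<longleftrightarrow>
     verts G \<noteq> {} \<and> (\<forall>u\<in>verts G. \<forall>v\<in>verts G. \<exists>xs. walk_betw G u xs v)"

(* Walks are given by their vertex sequence, so a walk of length k has k + 1 entries.
   The value is only meaningful if some walk from u to v exists. *)
definition gdist :: "'a ugraph \<Rightarrow> 'a \<Rightarrow> 'a \<Rightarrow> nat" where
  "gdist G u v = (LEAST k. \<exists>xs. walk_betw G u xs v \<and> length xs = Suc k)"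

definition ecc :: "'a ugraph \<Rightarrow> 'a \<Rightarrow> nat" where
  "ecc G v = Max (gdist G v ` verts G)"

definition regular_graph :: "nat \<Rightarrow> 'a ugraph \<Rightarrow> bool" where
  "regular_graph r G \<longleftrightarrow> (\<forall>v\<in>verts G. card {u \<in> verts G. adjacent G v u} = r)"

definition triangle_free :: "'a ugraph \<Rightarrow> bool" where
  "triangle_free G \<longleftrightarrow> \<not> (\<exists>u v w. adjacent G u v \<and> adjacent G v w \<and> adjacent G u w)"

(* Inl u is the original vertex u, Inr e is the subdivision vertex w_e. *)
definition central_graph :: "'a ugraph \<Rightarrow> ('a + 'a set) ugraph" where
  "central_graph G =
     \<lparr> verts = Inl ` verts G \<union> Inr ` edges G,
       edges = {{Inl u, Inr e} | u e. e \<in> edges G \<and> u \<in> e}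
             \<union> {{Inl u, Inl v} | u v. u \<in> verts G \<and> v \<in> verts G \<and> u \<noteq> v \<and> \<not> adjacent G u v} \<rparr>"

definition central_vertex_join ::
    "'a ugraph \<Rightarrow> 'b ugraph \<Rightarrow> (('a + 'a set) + 'b) ugraph" where
  "central_vertex_join G\<^sub>1 G\<^sub>2 =
     \<lparr> verts = Inl ` verts (central_graph G\<^sub>1) \<union> Inr ` verts G\<^sub>2,
       edges = image Inl ` edges (central_graph G\<^sub>1)
             \<union> image Inr ` edges G\<^sub>2
             \<union> {{Inl (Inl u), Inr v} | u v. u \<in> verts G\<^sub>1 \<and> v \<in> verts G\<^sub>2} \<rparr>"

(* A list vs with this property plays the role of the labelling v_1, ..., v_n. *)
definition vertex_order :: "'a ugraph \<Rightarrow> 'a list \<Rightarrow> bool" where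
  "vertex_order G vs \<longleftrightarrow> distinct vs \<and> set vs = verts G"

definition adjacency_mat :: "'a ugraph \<Rightarrow> 'a list \<Rightarrow> real mat" where
  "adjacency_mat G vs = mat (length vs) (length vs)
     (\<lambda>(i, j). if adjacent G (vs ! i) (vs ! j) then 1 else 0)"

definition eccentricity_mat :: "'a ugraph \<Rightarrow> 'a list \<Rightarrow> real mat" where
  "eccentricity_mat G vs = mat (length vs) (length vs)
     (\<lambda>(i, j). let u = vs ! i; v = vs ! j
               in if gdist G u v = min (ecc G u) (ecc G v) then real (gdist G u v) else 0)"

(* All complex eigenvalues with algebraic multiplicity, so that nothing is lost for the
   non-symmetric real quotient matrix. *)
definition eigenvalues :: "real mat \<Rightarrow> complex multiset" where
  "eigenvalues A = proots (char_poly (map_mat complex_of_real A))"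

end

theory Submission
  imports Defs
begin

text \<open>With \<open>A\<^sub>i\<close> the adjacency matrices, \<open>B\<close> the incidence matrix of \<open>G\<^sub>1\<close> and \<open>J\<close> all-ones blocks, the
  eccentricity matrix is the symmetric block matrix with rows
  \<open>(2 A\<^sub>1, 2 (J - B), 0)\<close>, \<open>(2 (J - B\<^sup>T), 3 (J + I - B\<^sup>T B), 2 J)\<close>, \<open>(0, 2 J, 2 (J - I - A\<^sub>2))\<close>.
  Vectors constant on the three vertex classes form an invariant subspace, on which the matrix acts as
  the quotient matrix; removing the \<open>J\<close> blocks only alters the action there. The remaining matrix
  splits off \<open>- 2 (I + A\<^sub>2)\<close>. The other block leaves the vectors \<open>(x, B\<^sup>T y)\<close> invariant, where
  \<open>B B\<^sup>T = A\<^sub>1 + r\<^sub>1 I\<close> yields a quadratic factor for every eigenvalue of \<open>A\<^sub>1\<close>, and is 3 elsewhere.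
  The factors coming from the eigenvalues \<open>r\<^sub>1\<close> and \<open>r\<^sub>2\<close> cancel against the reduced quotient matrix.\<close>

section \<open>Determinants and invariant subspaces\<close>

text \<open>Only the root multisets of the characteristic polynomials of \<open>A_1\<close> and
  \<open>A_2\<close> are given. Hence no eigenbasis is chosen: an invariant subspace appears as an
  intertwining \<open>M S = S Q\<close>, and spectra are compared through polynomial identities over
  the complex numbers. The columns of \<open>S\<close> may be dependent, since in the incidence step
  they are those of \<open>diag(I, B^T)\<close>, and \<open>B^T\<close> has a kernel when
  \<open>G_1\<close> is bipartite. A choice of basis would force case distinctions there; the
  cross-multiplied identity avoids them, and its surplus factors are nonzero polynomials that can be
  cancelled. On the graph side, the delicate entries belong to subdivision vertices of two meeting
  edges. Their distance is 2, so the entry is 0 only because both eccentricities are 3, and this is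
  where regularity and triangle-freeness combine.\<close>

lemma poly_char_poly:
  fixes A :: "'a :: field mat"
  assumes A: "A \<in> carrier_mat n n"
  shows "poly (char_poly A) x = det (x \<cdot>\<^sub>m 1\<^sub>m n - A)"
  unfolding char_poly_defs
  by (rule poly_det_cong[of _ n]) (use A in auto)

lemma poly_ext:
  fixes p q :: "'a :: {comm_ring_1,ring_no_zero_divisors,ring_char_0} poly"
  assumes "\<And>x. poly p x = poly q x"
  shows "p = q"
  using assms by (auto simp: poly_eq_poly_eq_iff[symmetric])

text \<open>When \<open>M S = S Q\<close>, a correction \<open>S R\<close> changes determinants only through the small matrices
  \<open>Q\<close> and \<open>R S\<close>. The block product below avoids inverting \<open>M\<close> or \<open>Q\<close>.\<close>

lemma det_intertwining:
  fixes M :: "'a :: idom mat"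
  assumes M: "M \<in> carrier_mat n n" and S: "S \<in> carrier_mat n k"
    and R: "R \<in> carrier_mat k n" and Q: "Q \<in> carrier_mat k k"
    and MS: "M * S = S * Q"
  shows "det (M + S * R) * det Q = det M * det (Q + R * S)"
proof -
  \<comment> \<open>The determinant of \<open>?K\<close> is found twice by column elimination:
    \<open>?U\<close> clears the lower left block, and by \<open>M S = S Q\<close> the matrix
    \<open>?V\<close> clears the upper right one. \<open>?U\<close> has determinant 1, whereas
    \<open>?V\<close> contributes the factor \<open>det Q\<close>.\<close>
  let ?K = "four_block_mat M S (- R) (1\<^sub>m k)"
  let ?U = "four_block_mat (1\<^sub>m n) (0\<^sub>m n k) R (1\<^sub>m k)"
  let ?V = "four_block_mat (1\<^sub>m n) (- S) (0\<^sub>m k n) Q"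
  have nR: "- R \<in> carrier_mat k n" and nS: "- S \<in> carrier_mat n k" using R S by auto
  have K: "?K \<in> carrier_mat (n + k) (n + k)" and U: "?U \<in> carrier_mat (n + k) (n + k)"
    and V: "?V \<in> carrier_mat (n + k) (n + k)"
    using M Q by (auto intro!: four_block_carrier_mat)
  have "?K * ?U = four_block_mat (M + S * R) S (0\<^sub>m k n) (1\<^sub>m k)"
    by (subst mult_four_block_mat[OF M S nR one_carrier_mat one_carrier_mat zero_carrier_mat R one_carrier_mat])
      (use M S R in \<open>auto intro!: cong_four_block_mat uminus_l_inv_mat\<close>)
  hence "det ?K * det ?U = det (M + S * R)"
    unfolding det_mult[OF K U, symmetric]
    by (simp, subst det_four_block_mat_lower_left_zero[of _ n _ k]) (use M S R in auto)
  moreover have "det ?U = 1"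
    by (subst det_four_block_mat_upper_right_zero[of _ n _ k]) (use R in auto)
  ultimately have 1: "det ?K = det (M + S * R)" by simp
  have "?K * ?V = four_block_mat M (0\<^sub>m n k) (- R) (Q + R * S)"
  proof (subst mult_four_block_mat[OF M S nR one_carrier_mat one_carrier_mat nS zero_carrier_mat Q],
      rule cong_four_block_mat)
    show "M * 1\<^sub>m n + S * 0\<^sub>m k n = M" using M S by simp
    have "M * (- S) = - (M * S)" using M S by (intro eq_matI) auto
    thus "M * - S + S * Q = 0\<^sub>m n k" using M S Q MS by (auto intro!: uminus_l_inv_mat)
    show "- R * 1\<^sub>m n + 1\<^sub>m k * 0\<^sub>m k n = - R" using R by simp
    have "- R * - S = R * S" using R S by (intro eq_matI) auto
    thus "- R * - S + 1\<^sub>m k * Q = Q + R * S" using R S Q by (auto intro: comm_add_mat)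
  qed
  hence "det ?K * det ?V = det M * det (Q + R * S)"
    unfolding det_mult[OF K V, symmetric]
    by (simp, subst det_four_block_mat_upper_right_zero[of _ n _ k]) (use M S R Q in auto)
  moreover have "det ?V = det Q"
    by (subst det_four_block_mat_lower_left_zero[of _ n _ k]) (use S Q in auto)
  ultimately show ?thesis using 1 by simp
qed

text \<open>The intertwining passes to \<open>x I - M\<close> and \<open>x I - Q\<close> with the
  same \<open>S\<close>, for every \<open>x\<close>. This is how a low-rank part \<open>S R\<close>
  is removed from a matrix at the cost of comparing only the two small matrices \<open>Q\<close> and
  \<open>Q - R S\<close>.\<close>

lemma char_poly_intertwining:
  fixes M :: "'a :: field_char_0 mat"
  assumes M: "M \<in> carrier_mat n n" and S: "S \<in> carrier_mat n k"
    and R: "R \<in> carrier_mat k n" and Q: "Q \<in> carrier_mat k k"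
    and MS: "M * S = S * Q"
  shows "char_poly (M - S * R) * char_poly Q = char_poly M * char_poly (Q - R * S)"
proof (rule poly_ext)
  fix x :: 'a
  let ?xM = "x \<cdot>\<^sub>m 1\<^sub>m n - M" and ?xQ = "x \<cdot>\<^sub>m 1\<^sub>m k - Q"
  have "?xM * S = x \<cdot>\<^sub>m S - M * S"
    using M S by (simp add: minus_mult_distrib_mat[of _ n n _ _ k] mult_smult_assoc_mat[of _ n n])
  also have "\<dots> = S * ?xQ"
    unfolding MS using S Q
    by (simp add: mult_minus_distrib_mat[of _ n k _ k] mult_smult_distrib[of _ n k _ k])
  finally have "?xM * S = S * ?xQ" .
  hence "det (?xM + S * R) * det ?xQ = det ?xM * det (?xQ + R * S)"
    using M S R Q by (intro det_intertwining) auto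
  moreover have "?xM + S * R = x \<cdot>\<^sub>m 1\<^sub>m n - (M - S * R)"
    "?xQ + R * S = x \<cdot>\<^sub>m 1\<^sub>m k - (Q - R * S)"
    using M S R Q by (auto intro!: eq_matI)
  ultimately show "poly (char_poly (M - S * R) * char_poly Q) x = poly (char_poly M * char_poly (Q - R * S)) x"
    using M Q minus_carrier_mat[OF mult_carrier_mat[OF S R], of M]
      minus_carrier_mat[OF mult_carrier_mat[OF R S], of Q]
    by (simp add: poly_char_poly[of _ n] poly_char_poly[of _ k])
qed

section \<open>Determinants of polynomials in a complex matrix\<close>

lemma char_poly_eq_prod_proots:
  fixes A :: "complex mat"
  assumes "A \<in> carrier_mat n n"
  shows "char_poly A = (\<Prod>a\<in>#proots (char_poly A). [:- a, 1:])"
  using complex_poly_decompose_multiset[of "char_poly A"] degree_monic_char_poly[OF assms] by simp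

lemma size_proots_char_poly:
  fixes A :: "complex mat"
  assumes "A \<in> carrier_mat n n"
  shows "size (proots (char_poly A)) = n"
  using size_proots_complex[of "char_poly A"] degree_monic_char_poly[OF assms] by simp

lemma prod_mset_const_mult:
  fixes c :: "'a :: comm_monoid_mult"
  shows "(\<Prod>a\<in>#L. c * f a) = c ^ size L * (\<Prod>a\<in>#L. f a)"
  by (induction L) (auto simp: ac_simps)

text \<open>Pulling out \<open>- c\<close> leaves the characteristic polynomial of \<open>A\<close>
  at \<open>- b / c\<close>. It splits over the complex numbers with exactly \<open>n\<close> roots,
  so the power \<open>(- c) ^ n\<close> distributes over the linear factors.\<close>

lemma det_linear_matrix_poly:
  fixes A :: "complex mat"
  assumes A: "A \<in> carrier_mat n n" and "c \<noteq> 0"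
  shows "det (b \<cdot>\<^sub>m 1\<^sub>m n + c \<cdot>\<^sub>m A) = (\<Prod>a\<in>#proots (char_poly A). b + c * a)"
proof -
  have "b \<cdot>\<^sub>m 1\<^sub>m n + c \<cdot>\<^sub>m A = (- c) \<cdot>\<^sub>m ((- b / c) \<cdot>\<^sub>m 1\<^sub>m n - A)"
    using A \<open>c \<noteq> 0\<close> by (auto intro!: eq_matI simp: field_simps)
  hence "det (b \<cdot>\<^sub>m 1\<^sub>m n + c \<cdot>\<^sub>m A) = (- c) ^ n * det ((- b / c) \<cdot>\<^sub>m 1\<^sub>m n - A)"
    using A by simp
  also have "det ((- b / c) \<cdot>\<^sub>m 1\<^sub>m n - A) = (\<Prod>a\<in>#proots (char_poly A). - b / c - a)"
    by (subst poly_char_poly[OF A, symmetric], subst char_poly_eq_prod_proots[OF A])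
      (auto simp: poly_prod_mset intro!: arg_cong[of _ _ prod_mset] image_mset_cong)
  also have "(- c) ^ n * \<dots> = (\<Prod>a\<in>#proots (char_poly A). (- c) * (- b / c - a))"
    by (simp only: prod_mset_const_mult size_proots_char_poly[OF A])
  also have "\<dots> = (\<Prod>a\<in>#proots (char_poly A). b + c * a)"
    using \<open>c \<noteq> 0\<close> by (simp add: right_diff_distrib)
  finally show ?thesis .
qed

text \<open>The coefficients come from \<open>(b + X) (d + c2 X) = c0 + c1 X + c2 X^2\<close>;
  \<open>b\<close> and \<open>d\<close> are given by the quadratic formula.\<close>

lemma quadratic_factors_complex:
  fixes c0 c1 c2 :: complex
  assumes "c2 \<noteq> 0"
  obtains b d where "c1 = d + b * c2" "c0 = b * d"
proof -
  define s where "s = csqrt (c1\<^sup>2 - 4 * c0 * c2)"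
  have s: "s\<^sup>2 = c1\<^sup>2 - 4 * c0 * c2" unfolding s_def by simp
  have "((c1 + s) / (2 * c2)) * ((c1 - s) / 2) = (c1\<^sup>2 - s\<^sup>2) / (4 * c2)"
    by (simp add: power2_eq_square algebra_simps)
  also have "\<dots> = c0" using assms unfolding s by simp
  finally show ?thesis
    using assms by (intro that[of "(c1 - s) / 2" "(c1 + s) / (2 * c2)"]) (auto simp: field_simps)
qed

text \<open>The scalar factorization into \<open>b + X\<close> and \<open>d + c2 X\<close> remains
  valid with \<open>A\<close> for \<open>X\<close>, which reduces the claim to two linear
  determinants without triangularizing \<open>A\<close>.\<close>

lemma det_quadratic_matrix_poly:
  fixes A :: "complex mat"
  assumes A: "A \<in> carrier_mat n n" and "c2 \<noteq> 0"
  shows "det (c0 \<cdot>\<^sub>m 1\<^sub>m n + c1 \<cdot>\<^sub>m A + c2 \<cdot>\<^sub>m (A * A)) =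
    (\<Prod>a\<in>#proots (char_poly A). c0 + c1 * a + c2 * a\<^sup>2)"
proof -
  obtain b d where bd: "c1 = d + b * c2" "c0 = b * d"
    using quadratic_factors_complex[OF \<open>c2 \<noteq> 0\<close>] .
  let ?B = "b \<cdot>\<^sub>m 1\<^sub>m n + 1 \<cdot>\<^sub>m A" and ?D = "d \<cdot>\<^sub>m 1\<^sub>m n + c2 \<cdot>\<^sub>m A"
  have carr: "?B \<in> carrier_mat n n" "?D \<in> carrier_mat n n" using A by auto
  have "?B * ?D = b \<cdot>\<^sub>m 1\<^sub>m n * ?D + 1 \<cdot>\<^sub>m A * ?D"
    using A by (intro add_mult_distrib_mat) auto
  also have "b \<cdot>\<^sub>m 1\<^sub>m n * ?D = b \<cdot>\<^sub>m ?D"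
    using A by (simp add: mult_smult_assoc_mat[of _ n n _ n])
  also have "1 \<cdot>\<^sub>m A * ?D = A * (d \<cdot>\<^sub>m 1\<^sub>m n) + A * (c2 \<cdot>\<^sub>m A)"
    using A by (subst mult_add_distrib_mat[of _ n n]) auto
  also have "A * (d \<cdot>\<^sub>m 1\<^sub>m n) = d \<cdot>\<^sub>m A" using A by (simp add: mult_smult_distrib[of _ n n _ n])
  also have "A * (c2 \<cdot>\<^sub>m A) = c2 \<cdot>\<^sub>m (A * A)" using A by (simp add: mult_smult_distrib[of _ n n _ n])
  also have "b \<cdot>\<^sub>m ?D + (d \<cdot>\<^sub>m A + c2 \<cdot>\<^sub>m (A * A)) = c0 \<cdot>\<^sub>m 1\<^sub>m n + c1 \<cdot>\<^sub>m A + c2 \<cdot>\<^sub>m (A * A)"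
    using A unfolding bd by (intro eq_matI) (auto simp: algebra_simps)
  finally have "det (c0 \<cdot>\<^sub>m 1\<^sub>m n + c1 \<cdot>\<^sub>m A + c2 \<cdot>\<^sub>m (A * A)) = det ?B * det ?D"
    using det_mult[OF carr] by simp
  also have "\<dots> = (\<Prod>a\<in>#proots (char_poly A). (b + 1 * a) * (d + c2 * a))"
    using A \<open>c2 \<noteq> 0\<close> by (simp only: det_linear_matrix_poly[OF A] prod_mset.distrib one_neq_zero not_False_eq_True)
  also have "\<dots> = (\<Prod>a\<in>#proots (char_poly A). c0 + c1 * a + c2 * a\<^sup>2)"
    unfolding bd by (simp add: algebra_simps power2_eq_square)
  finally show ?thesis .
qed

section \<open>Matrices indexed by lists\<close>

text \<open>Rows and columns are labelled by list entries rather than numbers: for distinct labels,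
  products become sums over sets of vertices or edges, and block decompositions become list
  concatenations.\<close>

definition fmat :: "'i list \<Rightarrow> 'j list \<Rightarrow> ('i \<Rightarrow> 'j \<Rightarrow> 'a) \<Rightarrow> 'a mat" where
  "fmat xs ys f = mat (length xs) (length ys) (\<lambda>(i, j). f (xs ! i) (ys ! j))"

lemma fmat_carrier [simp]: "fmat xs ys f \<in> carrier_mat (length xs) (length ys)"
  and dim_fmat [simp]: "dim_row (fmat xs ys f) = length xs" "dim_col (fmat xs ys f) = length ys"
  by (auto simp: fmat_def)

lemma index_fmat [simp]:
  "i < length xs \<Longrightarrow> j < length ys \<Longrightarrow> fmat xs ys f $$ (i, j) = f (xs ! i) (ys ! j)"
  by (simp add: fmat_def)

lemma fmat_cong:
  assumes "\<And>x y. x \<in> set xs \<Longrightarrow> y \<in> set ys \<Longrightarrow> f x y = g x y"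
  shows "fmat xs ys f = fmat xs ys g"
  using assms by (intro eq_matI) auto

lemma sum_nth_distinct:
  assumes "distinct ys"
  shows "(\<Sum>k = 0..<length ys. f (ys ! k)) = sum f (set ys)"
  using sum.reindex_bij_betw[OF bij_betw_nth[OF assms refl refl], of f]
  by (simp add: atLeast0LessThan)

lemma fmat_mult:
  assumes "distinct ys"
  shows "fmat xs ys f * fmat ys zs g = fmat xs zs (\<lambda>x z. \<Sum>y\<in>set ys. f x y * g y z)"
  by (rule eq_matI) (simp_all add: scalar_prod_def sum_nth_distinct[OF assms, symmetric])

lemma fmat_minus: "fmat xs ys f - fmat xs ys g = fmat xs ys (\<lambda>x y. f x y - g x y)"
  by (rule eq_matI) auto

lemma fmat_map: "fmat (map h xs) (map k ys) f = fmat xs ys (\<lambda>x y. f (h x) (k y))"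
  by (rule eq_matI) auto

lemma fmat_append:
  "fmat (xs @ xs') (ys @ ys') f =
    four_block_mat (fmat xs ys f) (fmat xs ys' f) (fmat xs' ys f) (fmat xs' ys' f)"
  by (rule eq_matI) (auto simp: nth_append)

lemma fmat_zero: "fmat xs ys (\<lambda>_ _. 0) = 0\<^sub>m (length xs) (length ys)"
  by (rule eq_matI) auto

lemma fmat_one:
  assumes "distinct xs"
  shows "fmat xs xs (\<lambda>x y. if x = y then 1 else 0) = 1\<^sub>m (length xs)"
  using assms by (intro eq_matI) (auto simp: nth_eq_iff_index_eq)

text \<open>Relabelling is conjugation by the permutation matrix \<open>e\<close>. This lets the
  arbitrary ordering of the join be replaced by one that lists the three vertex classes
  consecutively.\<close>

lemma char_poly_fmat_reorder:
  fixes f :: "'i \<Rightarrow> 'i \<Rightarrow> 'a :: comm_ring_1"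
  assumes "distinct xs" "distinct ys" "set xs = set ys"
  shows "char_poly (fmat xs xs f) = char_poly (fmat ys ys f)"
proof (rule char_poly_similar)
  define e :: "'i \<Rightarrow> 'i \<Rightarrow> 'a" where "e = (\<lambda>x y. if x = y then 1 else 0)"
  have len: "length xs = length ys"
    using assms(3) by (simp flip: distinct_card[OF assms(1)] distinct_card[OF assms(2)])
  have [simp]: "(if P then 1 else 0) * w = (if P then w else 0)"
    "w * (if P then 1 else 0) = (if P then w else 0)" for P and w :: 'a by auto
  have 1: "fmat xs ys e * fmat ys xs e = 1\<^sub>m (length xs)"
    unfolding fmat_mult[OF assms(2)] fmat_one[OF assms(1), symmetric]
    by (rule fmat_cong) (simp add: e_def assms(3))
  have 2: "fmat ys xs e * fmat xs ys e = 1\<^sub>m (length xs)"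
    unfolding fmat_mult[OF assms(1)] len fmat_one[OF assms(2), symmetric]
    by (rule fmat_cong) (simp add: e_def assms(3))
  have 3: "fmat xs xs f = fmat xs ys e * fmat ys ys f * fmat ys xs e"
    unfolding fmat_mult[OF assms(2)]
    by (rule fmat_cong) (simp add: e_def assms(3))
  have 4: "{fmat xs xs f, fmat ys ys f, fmat xs ys e, fmat ys xs e}
      \<subseteq> carrier_mat (length xs) (length xs)"
    using fmat_carrier[of xs xs f] fmat_carrier[of ys ys f] fmat_carrier[of xs ys e] fmat_carrier[of ys xs e]
    by (simp only: len insert_subset empty_subsetI simp_thms)
  show "similar_mat (fmat xs xs f) (fmat ys ys f)"
    by (rule similar_matI) (fact 4 1 2 3)+
qed

text \<open>Entrywise form of the intertwining identity. \<open>M'\<close> and \<open>Q'\<close> are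
  prescribed through their entries, so that each condition can be checked by cases on the vertex
  classes.\<close>

lemma char_poly_fmat_intertwining:
  fixes M :: "'i \<Rightarrow> 'i \<Rightarrow> 'a :: field_char_0"
  assumes "distinct xs" "distinct ys"
    and "\<And>i c. i \<in> set xs \<Longrightarrow> c \<in> set ys \<Longrightarrow>
      (\<Sum>j\<in>set xs. M i j * S j c) = (\<Sum>d\<in>set ys. S i d * Q d c)"
    and "\<And>i j. i \<in> set xs \<Longrightarrow> j \<in> set xs \<Longrightarrow> M' i j = M i j - (\<Sum>d\<in>set ys. S i d * R d j)"
    and "\<And>c d. c \<in> set ys \<Longrightarrow> d \<in> set ys \<Longrightarrow> Q' c d = Q c d - (\<Sum>j\<in>set xs. R c j * S j d)"
  shows "char_poly (fmat xs xs M') * char_poly (fmat ys ys Q) =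
    char_poly (fmat xs xs M) * char_poly (fmat ys ys Q')"
proof -
  have *: "fmat xs xs M * fmat xs ys S = fmat xs ys S * fmat ys ys Q"
    unfolding fmat_mult[OF assms(1)] fmat_mult[OF assms(2)] by (rule fmat_cong) (fact assms(3))
  have **: "fmat xs xs M' = fmat xs xs M - fmat xs ys S * fmat ys xs R"
    unfolding fmat_mult[OF assms(2)] fmat_minus by (rule fmat_cong) (fact assms(4))
  have ***: "fmat ys ys Q' = fmat ys ys Q - fmat ys xs R * fmat xs ys S"
    unfolding fmat_mult[OF assms(1)] fmat_minus by (rule fmat_cong) (fact assms(5))
  show ?thesis
    unfolding ** *** by (rule char_poly_intertwining[OF fmat_carrier fmat_carrier fmat_carrier fmat_carrier *])
qed

lemma char_poly_fmat_append:
  fixes f :: "'i \<Rightarrow> 'i \<Rightarrow> 'a :: field_char_0"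
  assumes "\<And>x y. x \<in> set xs \<Longrightarrow> y \<in> set ys \<Longrightarrow> f x y = 0"
  shows "char_poly (fmat (xs @ ys) (xs @ ys) f) = char_poly (fmat xs xs f) * char_poly (fmat ys ys f)"
proof (rule poly_ext)
  fix x :: 'a
  let ?m = "length xs" and ?n = "length ys"
  have "fmat xs ys f = 0\<^sub>m ?m ?n"
    by (rule trans[OF fmat_cong fmat_zero]) (rule assms)
  hence "x \<cdot>\<^sub>m 1\<^sub>m (?m + ?n) - fmat (xs @ ys) (xs @ ys) f =
      four_block_mat (x \<cdot>\<^sub>m 1\<^sub>m ?m - fmat xs xs f) (0\<^sub>m ?m ?n) (- fmat ys xs f) (x \<cdot>\<^sub>m 1\<^sub>m ?n - fmat ys ys f)"
    unfolding fmat_append by (intro eq_matI) auto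
  moreover have "fmat (xs @ ys) (xs @ ys) f \<in> carrier_mat (?m + ?n) (?m + ?n)"
    using fmat_carrier[of "xs @ ys" "xs @ ys" f] by simp
  ultimately show "poly (char_poly (fmat (xs @ ys) (xs @ ys) f)) x =
      poly (char_poly (fmat xs xs f) * char_poly (fmat ys ys f)) x"
    by (simp add: poly_char_poly[of _ "?m + ?n"] poly_char_poly[OF fmat_carrier])
      (subst det_four_block_mat_upper_right_zero[of _ ?m _ ?n], auto)
qed

section \<open>Distances and eccentricities\<close>

lemma adjacent_commute: "adjacent G u v \<longleftrightarrow> adjacent G v u"
  by (simp add: adjacent_def insert_commute)

lemma simple_graph_not_adjacent_self: "simple_graph G \<Longrightarrow> \<not> adjacent G v v"
  by (auto simp: simple_graph_def adjacent_def)

lemma simple_graph_adjacentD: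
  assumes "simple_graph G" "adjacent G u v"
  shows "u \<in> verts G" "v \<in> verts G" "u \<noteq> v"
  using assms by (auto simp: simple_graph_def adjacent_def)

lemma simple_graph_edgeE:
  assumes "simple_graph G" "e \<in> edges G"
  obtains a b where "e = {a, b}" "a \<noteq> b" "a \<in> verts G" "b \<in> verts G" "adjacent G a b"
proof -
  have "e \<subseteq> verts G" "card e = 2" using assms by (auto simp: simple_graph_def)
  then obtain a b where "e = {a, b}" "a \<noteq> b" by (auto simp: card_2_iff)
  with \<open>e \<subseteq> verts G\<close> assms(2) show ?thesis by (intro that) (auto simp: adjacent_def)
qed

lemma incident_edgeE:
  assumes "simple_graph G" "e \<in> edges G" "a \<in> e"
  obtains b where "e = {a, b}" "a \<noteq> b" "adjacent G a b" "b \<in> verts G"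
proof -
  obtain x y where xy: "e = {x, y}" "x \<noteq> y" "x \<in> verts G" "y \<in> verts G" "adjacent G x y"
    using simple_graph_edgeE[OF assms(1,2)] .
  show ?thesis
  proof (cases "a = x")
    case True
    thus ?thesis using xy that[of y] by simp
  next
    case False
    hence "a = y" using xy assms(3) by simp
    thus ?thesis using xy that[of x] by (simp add: insert_commute adjacent_def)
  qed
qed

lemma simple_graph_finite_edges: "simple_graph G \<Longrightarrow> finite (edges G)"
  unfolding simple_graph_def by (auto intro: finite_subset[of _ "Pow (verts G)"])

text \<open>Making the length explicit allows recursion on the first step, so that distances up to 3
  are decided by inspecting neighbours.\<close>

definition walk_len :: "'a ugraph \<Rightarrow> nat \<Rightarrow> 'a \<Rightarrow> 'a \<Rightarrow> bool" where
  "walk_len G k u v \<longleftrightarrow> (\<exists>xs. walk_betw G u xs v \<and> length xs = Suc k)"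

lemma walk_len_0: "walk_len G 0 u v \<longleftrightarrow> u = v \<and> u \<in> verts G"
proof
  assume "u = v \<and> u \<in> verts G"
  thus "walk_len G 0 u v" unfolding walk_len_def
    by (intro exI[of _ "[u]"]) (auto simp: walk_betw_def)
qed (auto simp: walk_len_def walk_betw_def length_Suc_conv)

lemma walk_len_Suc:
  "walk_len G (Suc k) u v \<longleftrightarrow> u \<in> verts G \<and> (\<exists>w. adjacent G u w \<and> walk_len G k w v)"
proof
  assume "walk_len G (Suc k) u v"
  then obtain x y xs where "walk_betw G u (x # y # xs) v" "length xs = k"
    by (auto simp: walk_len_def length_Suc_conv)
  hence "u \<in> verts G" "adjacent G u y" "walk_betw G y (y # xs) v" "length (y # xs) = Suc k"
    by (auto simp: walk_betw_def)
  thus "u \<in> verts G \<and> (\<exists>w. adjacent G u w \<and> walk_len G k w v)"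
    unfolding walk_len_def by blast
next
  assume "u \<in> verts G \<and> (\<exists>w. adjacent G u w \<and> walk_len G k w v)"
  then obtain w xs where "u \<in> verts G" "adjacent G u w" "walk_betw G w xs v" "length xs = Suc k"
    unfolding walk_len_def by blast
  hence "walk_betw G u (u # xs) v \<and> length (u # xs) = Suc (Suc k)"
    by (auto simp: walk_betw_def successively_Cons)
  thus "walk_len G (Suc k) u v" unfolding walk_len_def by blast
qed

lemma walk_len_sym:
  assumes "walk_len G k u v"
  shows "walk_len G k v u"
proof -
  obtain xs where "walk_betw G u xs v" "length xs = Suc k"
    using assms by (auto simp: walk_len_def)
  hence "walk_betw G v (rev xs) u" "length (rev xs) = Suc k"
    by (auto simp: walk_betw_def hd_rev last_rev adjacent_commute)
  thus ?thesis unfolding walk_len_def by blast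
qed

lemma gdist_commute: "gdist G u v = gdist G v u"
proof -
  have "walk_len G k u v = walk_len G k v u" for k using walk_len_sym by metis
  thus ?thesis by (simp add: gdist_def walk_len_def)
qed

lemma gdist_eqI:
  assumes "walk_len G k u v" "\<And>l. l < k \<Longrightarrow> \<not> walk_len G l u v"
  shows "gdist G u v = k"
  unfolding gdist_def walk_len_def[symmetric]
  using assms by (intro Least_equality) (auto simp: not_less[symmetric])

lemma gdist_self: "u \<in> verts G \<Longrightarrow> gdist G u u = 0"
  by (rule gdist_eqI) (auto simp: walk_len_0)

lemma gdist_1:
  assumes "u \<noteq> v" "u \<in> verts G" "v \<in> verts G" "adjacent G u v"
  shows "gdist G u v = 1"
  using assms by (intro gdist_eqI) (auto simp: walk_len_0 walk_len_Suc)

lemma gdist_2: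
  assumes "u \<noteq> v" "\<not> adjacent G u v" "{u, v, w} \<subseteq> verts G" "adjacent G u w" "adjacent G w v"
  shows "gdist G u v = 2"
  using assms
  by (intro gdist_eqI) (auto simp: walk_len_0 walk_len_Suc numeral_2_eq_2 less_Suc_eq)

lemma gdist_3:
  assumes "u \<noteq> v" "\<not> adjacent G u v" "\<And>w. adjacent G u w \<Longrightarrow> \<not> adjacent G w v"
    "{u, v, a, b} \<subseteq> verts G" "adjacent G u a" "adjacent G a b" "adjacent G b v"
  shows "gdist G u v = 3"
  using assms
  by (intro gdist_eqI) (auto simp: walk_len_0 walk_len_Suc numeral_3_eq_3 less_Suc_eq)

lemma ecc_eqI:
  assumes "finite (verts G)" "\<And>w. w \<in> verts G \<Longrightarrow> gdist G v w \<le> k" "u \<in> verts G" "gdist G v u = k"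
  shows "ecc G v = k"
  unfolding ecc_def using assms by (intro Max_eqI) auto

lemma ecc_ge: "finite (verts G) \<Longrightarrow> u \<in> verts G \<Longrightarrow> gdist G v u \<le> ecc G v"
  unfolding ecc_def by (intro Max_ge) auto

lemma image_pair_in_images:
  assumes "inj h"
  shows "{h x, h y} \<in> image h ` E \<longleftrightarrow> {x, y} \<in> E"
proof -
  have "inj (image h)" using assms by (simp add: inj_on_def inj_image_eq_iff)
  thus ?thesis using inj_image_mem_iff[of "image h" "{x, y}" E] by simp
qed

lemma doubleton_Inl_Inr [simp]:
  "{Inl x, Inr y} \<in> image Inl ` E \<longleftrightarrow> False" "{Inl x, Inr y} \<in> image Inr ` F \<longleftrightarrow> False"
  "{Inl x, Inl z} \<in> image Inr ` F \<longleftrightarrow> False" "{Inr y, Inr w} \<in> image Inl ` E \<longleftrightarrow> False"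
proof -
  have "Inl x \<notin> Inr ` A" "Inr y \<notin> Inl ` B" for A B by auto
  thus "{Inl x, Inr y} \<in> image Inl ` E \<longleftrightarrow> False" "{Inl x, Inr y} \<in> image Inr ` F \<longleftrightarrow> False"
    "{Inl x, Inl z} \<in> image Inr ` F \<longleftrightarrow> False" "{Inr y, Inr w} \<in> image Inl ` E \<longleftrightarrow> False"
    by (auto simp: image_iff set_eq_iff)
qed

text \<open>Connectedness enters through \<open>r_pos\<close> and the two nonemptiness assumptions;
  the distances in the join are then at most 3 by explicit walks through
  \<open>verts G\<close>.\<close>

locale central_join =
  fixes G :: "'a ugraph" and H :: "'b ugraph" and r :: nat
  assumes simple_G: "simple_graph G" and simple_H: "simple_graph H"
    and regular_G: "regular_graph r G" and triangle_free_G: "triangle_free G"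
    and r_pos: "r > 0" and verts_G: "verts G \<noteq> {}" and verts_H: "verts H \<noteq> {}"
begin

abbreviation J where "J \<equiv> central_vertex_join G H"
abbreviation vtx :: "'a \<Rightarrow> ('a + 'a set) + 'b" where "vtx u \<equiv> Inl (Inl u)"
abbreviation mid :: "'a set \<Rightarrow> ('a + 'a set) + 'b" where "mid e \<equiv> Inl (Inr e)"
abbreviation new :: "'b \<Rightarrow> ('a + 'a set) + 'b" where "new w \<equiv> Inr w"

lemma verts_J [simp]: "verts J = vtx ` verts G \<union> mid ` edges G \<union> new ` verts H"
  by (auto simp: central_vertex_join_def central_graph_def)

lemma finite_verts_G: "finite (verts G)" and finite_verts_H: "finite (verts H)"
  using simple_G simple_H by (auto simp: simple_graph_def)

lemma finite_edges_G: "finite (edges G)"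
  using simple_graph_finite_edges[OF simple_G] .

lemma finite_verts_J: "finite (verts J)"
  using finite_verts_G finite_verts_H finite_edges_G by simp

lemma adjacent_J_vtx_vtx [simp]:
  "adjacent J (vtx u) (vtx v) \<longleftrightarrow> u \<in> verts G \<and> v \<in> verts G \<and> u \<noteq> v \<and> \<not> adjacent G u v"
  by (auto simp: adjacent_def central_vertex_join_def central_graph_def image_pair_in_images
      doubleton_eq_iff insert_commute)

lemma adjacent_J_vtx_mid [simp]:
  "adjacent J (vtx u) (mid e) \<longleftrightarrow> e \<in> edges G \<and> u \<in> e"
  by (auto simp: adjacent_def central_vertex_join_def central_graph_def image_pair_in_images
      doubleton_eq_iff)

lemma adjacent_J_mid_vtx [simp]:
  "adjacent J (mid e) (vtx u) \<longleftrightarrow> e \<in> edges G \<and> u \<in> e"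
  using adjacent_J_vtx_mid adjacent_commute by metis

lemma adjacent_J_mid_mid [simp]: "\<not> adjacent J (mid e) (mid f)"
  by (auto simp: adjacent_def central_vertex_join_def central_graph_def image_pair_in_images
      doubleton_eq_iff)

lemma adjacent_J_mid_new [simp]: "\<not> adjacent J (mid e) (new w)"
  by (auto simp: adjacent_def central_vertex_join_def central_graph_def doubleton_eq_iff)

lemma adjacent_J_new_mid [simp]: "\<not> adjacent J (new w) (mid e)"
  using adjacent_J_mid_new adjacent_commute by metis

lemma adjacent_J_vtx_new [simp]:
  "adjacent J (vtx u) (new w) \<longleftrightarrow> u \<in> verts G \<and> w \<in> verts H"
  by (auto simp: adjacent_def central_vertex_join_def central_graph_def doubleton_eq_iff)

lemma adjacent_J_new_vtx [simp]:
  "adjacent J (new w) (vtx u) \<longleftrightarrow> u \<in> verts G \<and> w \<in> verts H"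
  using adjacent_J_vtx_new adjacent_commute by metis

lemma adjacent_J_new_new [simp]: "adjacent J (new w) (new z) \<longleftrightarrow> adjacent H w z"
  by (auto simp: adjacent_def central_vertex_join_def image_pair_in_images doubleton_eq_iff)

lemma neighbour_other:
  assumes "u \<in> verts G" "card X < r" "finite X"
  obtains v where "v \<in> verts G" "adjacent G u v" "v \<notin> X"
proof -
  let ?N = "{v \<in> verts G. adjacent G u v}"
  have "card ?N = r" using regular_G assms(1) by (simp add: regular_graph_def)
  hence "\<not> ?N \<subseteq> X" using assms(2,3) card_mono by (metis not_less)
  thus ?thesis using that by blast
qed

lemma no_triangle: "adjacent G u v \<Longrightarrow> adjacent G v w \<Longrightarrow> \<not> adjacent G u w"
  using triangle_free_G by (auto simp: triangle_free_def)

lemma edge_exists: obtains e where "e \<in> edges G"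
proof -
  obtain u where "u \<in> verts G" using verts_G by blast
  then obtain v where "adjacent G u v" using neighbour_other[of u "{}"] r_pos by auto
  thus ?thesis using that by (auto simp: adjacent_def)
qed

section \<open>Distances in the join\<close>

lemma gdist_vtx_vtx:
  assumes "u \<in> verts G" "v \<in> verts G" "u \<noteq> v"
  shows "gdist J (vtx u) (vtx v) = (if adjacent G u v then 2 else 1)"
proof (cases "adjacent G u v")
  case True
  \<comment> \<open>The original edge is absent from the central graph, but its subdivision vertex
    is a common neighbour of both ends.\<close>
  thus ?thesis using assms
    by (auto intro!: gdist_2[of _ _ _ "mid {u, v}"] simp: adjacent_def[of G])
next
  case False
  thus ?thesis using assms by (auto intro!: gdist_1[unfolded One_nat_def])
qed

lemma gdist_vtx_mid:
  assumes "u \<in> verts G" "e \<in> edges G"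
  shows "gdist J (vtx u) (mid e) = (if u \<in> e then 1 else 2)"
proof (cases "u \<in> e")
  case True
  thus ?thesis using assms by (auto intro!: gdist_1[unfolded One_nat_def])
next
  case False
  obtain a b where ab: "e = {a, b}" "a \<in> verts G" "b \<in> verts G" "adjacent G a b"
    using simple_graph_edgeE[OF simple_G assms(2)] by metis
  \<comment> \<open>By triangle-freeness \<open>u\<close> misses an endpoint of \<open>e\<close>;
    the central graph joins \<open>u\<close> to that endpoint, which gives a walk of length
    2.\<close>
  have "\<not> adjacent G u a \<or> \<not> adjacent G u b"
    using no_triangle[of u a b] ab by blast
  then obtain c where c: "c \<in> e" "c \<in> verts G" "\<not> adjacent G u c" using ab by blast
  hence "gdist J (vtx u) (mid e) = 2"
    using assms False by (intro gdist_2[of _ _ _ "vtx c"]) auto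
  thus ?thesis using False by simp
qed

lemma gdist_vtx_new:
  "u \<in> verts G \<Longrightarrow> w \<in> verts H \<Longrightarrow> gdist J (vtx u) (new w) = 1"
  by (intro gdist_1) auto

lemma gdist_new_new:
  assumes "w \<in> verts H" "z \<in> verts H" "w \<noteq> z"
  shows "gdist J (new w) (new z) = (if adjacent H w z then 1 else 2)"
proof -
  obtain u where "u \<in> verts G" using verts_G by blast
  thus ?thesis using assms
    by (auto intro!: gdist_1[unfolded One_nat_def] gdist_2[of _ _ _ "vtx u"])
qed

lemma gdist_mid_new:
  assumes "e \<in> edges G" "w \<in> verts H"
  shows "gdist J (mid e) (new w) = 2"
proof -
  obtain a b where "e = {a, b}" "a \<in> verts G"
    using simple_graph_edgeE[OF simple_G assms(1)] by metis
  thus ?thesis using assms by (intro gdist_2[of _ _ _ "vtx a"]) auto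
qed

text \<open>The neighbours of a subdivision vertex are just the two ends of its edge, so distance 2
  means a shared end. For disjoint edges, triangle-freeness yields nonadjacent ends
  \<open>a'\<close> of \<open>e\<close> and \<open>c\<close> of \<open>f\<close>, and these are
  joined in the central graph.\<close>

lemma gdist_mid_mid:
  assumes "e \<in> edges G" "f \<in> edges G" "e \<noteq> f"
  shows "gdist J (mid e) (mid f) = (if e \<inter> f = {} then 3 else 2)"
proof (cases "e \<inter> f = {}")
  case True
  obtain a b where ab: "e = {a, b}" "a \<in> verts G" "b \<in> verts G" "adjacent G a b"
    using simple_graph_edgeE[OF simple_G assms(1)] by metis
  obtain c d where cd: "f = {c, d}" "c \<in> verts G" "d \<in> verts G" "adjacent G c d"
    using simple_graph_edgeE[OF simple_G assms(2)] by metis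
  have "\<not> adjacent G c a \<or> \<not> adjacent G c b"
    using no_triangle[of c a b] ab by blast
  then obtain a' where a': "a' \<in> e" "a' \<in> verts G" "\<not> adjacent G c a'" using ab by blast
  have "\<not> adjacent J w (mid f)" if "adjacent J (mid e) w" for w
  proof (cases w)
    case (Inl x)
    thus ?thesis using that True by (cases x) auto
  next
    case (Inr x)
    thus ?thesis using that True by auto
  qed
  hence "gdist J (mid e) (mid f) = 3"
    using a' cd True assms by (intro gdist_3[of _ _ _ "vtx a'" "vtx c"]) (auto simp: adjacent_commute[of G a' c])
  thus ?thesis using True by simp
next
  case False
  then obtain u where "u \<in> e" "u \<in> f" by blast
  moreover from this have "u \<in> verts G" using assms simple_G by (auto simp: simple_graph_def)
  ultimately have "gdist J (mid e) (mid f) = 2"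
    using assms by (intro gdist_2[of _ _ _ "vtx u"]) auto
  thus ?thesis using False by simp
qed

lemmas gdist_J = gdist_vtx_vtx gdist_vtx_mid gdist_vtx_new gdist_new_new gdist_mid_new gdist_mid_mid
  gdist_vtx_mid[unfolded gdist_commute[of J "vtx _"]]
  gdist_vtx_new[unfolded gdist_commute[of J "vtx _"]]
  gdist_mid_new[unfolded gdist_commute[of J "mid _"]]

lemma gdist_vtx_vtx_le: "u \<in> verts G \<Longrightarrow> v \<in> verts G \<Longrightarrow> gdist J (vtx u) (vtx v) \<le> 2"
  using gdist_vtx_vtx[of u v] gdist_self[of "vtx u" J] by (cases "u = v") auto

lemma gdist_new_new_le: "w \<in> verts H \<Longrightarrow> z \<in> verts H \<Longrightarrow> gdist J (new w) (new z) \<le> 2"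
  using gdist_new_new[of w z] gdist_self[of "new w" J] by (cases "w = z") auto

lemma gdist_mid_mid_le: "e \<in> edges G \<Longrightarrow> f \<in> edges G \<Longrightarrow> gdist J (mid e) (mid f) \<le> 3"
  using gdist_mid_mid[of e f] gdist_self[of "mid e" J] by (cases "e = f") auto

section \<open>Eccentricities in the join\<close>

lemma ecc_vtx:
  assumes "u \<in> verts G"
  shows "ecc J (vtx u) = 2"
proof -
  obtain v where v: "v \<in> verts G" "adjacent G u v"
    using neighbour_other[of u "{}"] assms r_pos by auto
  hence "u \<noteq> v" using simple_graph_not_adjacent_self[OF simple_G] by auto
  have "gdist J (vtx u) w \<le> 2" if "w \<in> verts J" for w
    using that assms gdist_vtx_vtx_le[of u] by (auto simp: gdist_J split: if_splits)
  thus ?thesis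
    using assms v \<open>u \<noteq> v\<close> finite_verts_J by (intro ecc_eqI[of _ _ _ "vtx v"]) (auto simp: gdist_J)
qed

lemma ecc_new:
  assumes "w \<in> verts H"
  shows "ecc J (new w) = 2"
proof -
  obtain e where e: "e \<in> edges G" using edge_exists .
  have "gdist J (new w) z \<le> 2" if "z \<in> verts J" for z
    using that assms gdist_new_new_le[of w] by (auto simp: gdist_J split: if_splits)
  thus ?thesis
    using assms e finite_verts_J by (intro ecc_eqI[of _ _ _ "mid e"]) (auto simp: gdist_J)
qed

text \<open>The exact value depends on whether some edge is disjoint from \<open>e\<close>. The
  lower bound is enough for the diagonal and for entries against the other two classes, whose
  eccentricity is 2.\<close>

lemma ecc_mid_ge:
  assumes "e \<in> edges G"
  shows "ecc J (mid e) \<ge> 2"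
proof -
  obtain w where "w \<in> verts H" using verts_H by blast
  thus ?thesis using ecc_ge[OF finite_verts_J, of "new w" "mid e"] assms by (simp add: gdist_J)
qed

lemma ecc_mid_disjoint:
  assumes "e \<in> edges G" "f \<in> edges G" "e \<inter> f = {}"
  shows "ecc J (mid e) = 3"
proof -
  have "e \<noteq> f" using assms simple_G by (auto simp: simple_graph_def)
  have "gdist J (mid e) z \<le> 3" if "z \<in> verts J" for z
    using that assms gdist_mid_mid_le[of e] by (auto simp: gdist_J split: if_splits)
  thus ?thesis
    using assms \<open>e \<noteq> f\<close> finite_verts_J by (intro ecc_eqI[of _ _ _ "mid f"]) (auto simp: gdist_J)
qed

text \<open>Two edges at a vertex \<open>a\<close> force \<open>r\<close> to be at least 2, so the
  other end \<open>c\<close> of \<open>f\<close> has a neighbour \<open>d\<close> different from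
  \<open>a\<close>; \<open>d = b\<close> would close a triangle, so \<open>{c, d}\<close> avoids
  \<open>e\<close>. Consequently subdivision vertices of meeting edges have eccentricity 3, and
  their distance 2 is not recorded in the matrix.\<close>

lemma disjoint_edge_exists:
  assumes "e \<in> edges G" "f \<in> edges G" "e \<noteq> f" "e \<inter> f \<noteq> {}"
  obtains g where "g \<in> edges G" "e \<inter> g = {}"
proof -
  obtain a where a: "a \<in> e" "a \<in> f" using assms by blast
  obtain b where b: "e = {a, b}" "a \<noteq> b" "adjacent G a b" "b \<in> verts G"
    using incident_edgeE[OF simple_G assms(1) a(1)] .
  obtain c where c: "f = {a, c}" "a \<noteq> c" "adjacent G a c" "c \<in> verts G"
    using incident_edgeE[OF simple_G assms(2) a(2)] .
  have "b \<noteq> c" using assms b c by auto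
  have "{b, c} \<subseteq> {v \<in> verts G. adjacent G a v}" "a \<in> verts G"
    using b c simple_graph_adjacentD[OF simple_G] by blast+
  hence "card {b, c} \<le> r"
    using regular_G card_mono[of "{v \<in> verts G. adjacent G a v}" "{b, c}"] finite_verts_G
    by (auto simp: regular_graph_def)
  hence "card {a} < r" using \<open>b \<noteq> c\<close> by simp
  then obtain d where d: "adjacent G c d" "d \<noteq> a"
    using neighbour_other[of c "{a}"] c by auto
  have "d \<noteq> b" using no_triangle[of a c b] b c d by auto
  hence "e \<inter> {c, d} = {}" using b c d \<open>b \<noteq> c\<close> by auto
  thus ?thesis using d that by (auto simp: adjacent_def)
qed

section \<open>Entries of the eccentricity matrix of the join\<close>

definition ecc_entry :: "('a + 'a set) + 'b \<Rightarrow> ('a + 'a set) + 'b \<Rightarrow> real" where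
  "ecc_entry x y = (if gdist J x y = min (ecc J x) (ecc J y) then real (gdist J x y) else 0)"

lemma ecc_entry_commute: "ecc_entry x y = ecc_entry y x"
  unfolding ecc_entry_def by (subst (1 2) gdist_commute) (simp only: min.commute)

lemma ecc_entry_vtx_vtx:
  assumes "u \<in> verts G" "v \<in> verts G"
  shows "ecc_entry (vtx u) (vtx v) = (if adjacent G u v then 2 else 0)"
  using assms simple_graph_not_adjacent_self[OF simple_G] gdist_self[of "vtx u" J]
  by (cases "u = v") (auto simp: ecc_entry_def ecc_vtx gdist_J)

lemma ecc_entry_vtx_mid:
  assumes "u \<in> verts G" "e \<in> edges G"
  shows "ecc_entry (vtx u) (mid e) = (if u \<in> e then 0 else 2)"
  using assms ecc_mid_ge[of e] by (auto simp: ecc_entry_def ecc_vtx gdist_J)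

lemma ecc_entry_vtx_new:
  assumes "u \<in> verts G" "w \<in> verts H"
  shows "ecc_entry (vtx u) (new w) = 0"
  using assms by (auto simp: ecc_entry_def ecc_vtx ecc_new gdist_J)

lemma ecc_entry_mid_new:
  assumes "e \<in> edges G" "w \<in> verts H"
  shows "ecc_entry (mid e) (new w) = 2"
  using assms ecc_mid_ge[of e] by (auto simp: ecc_entry_def ecc_new gdist_J)

lemma ecc_entry_new_new:
  assumes "w \<in> verts H" "z \<in> verts H"
  shows "ecc_entry (new w) (new z) = (if w = z \<or> adjacent H w z then 0 else 2)"
  using assms gdist_self[of "new w" J]
  by (cases "w = z") (auto simp: ecc_entry_def ecc_new gdist_J)

lemma ecc_entry_mid_mid:
  assumes e: "e \<in> edges G" and f: "f \<in> edges G"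
  shows "ecc_entry (mid e) (mid f) = (if e \<inter> f = {} then 3 else 0)"
proof -
  have "e \<noteq> {}" using e simple_G by (auto simp: simple_graph_def)
  consider "e = f" | "e \<noteq> f" "e \<inter> f \<noteq> {}" | "e \<noteq> f" "e \<inter> f = {}" by blast
  thus ?thesis
  proof cases
    case 1
    thus ?thesis using ecc_mid_ge[OF f] e gdist_self[of "mid f" J] \<open>e \<noteq> {}\<close>
      by (auto simp: ecc_entry_def)
  next
    case 2
    obtain g where "g \<in> edges G" "e \<inter> g = {}" using disjoint_edge_exists[OF e f 2] .
    hence "ecc J (mid e) = 3" by (rule ecc_mid_disjoint[OF e])
    moreover obtain h where "h \<in> edges G" "f \<inter> h = {}"
      using disjoint_edge_exists[OF f e] 2 by (metis inf_commute)
    hence "ecc J (mid f) = 3" by (rule ecc_mid_disjoint[OF f])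
    ultimately show ?thesis using 2 e f by (simp add: ecc_entry_def gdist_J)
  next
    case 3
    thus ?thesis using ecc_mid_disjoint[OF e f] ecc_mid_disjoint[OF f e] e f
      by (simp add: ecc_entry_def gdist_J Int_commute)
  qed
qed

lemma eccentricity_mat_J: "eccentricity_mat J vs = fmat vs vs ecc_entry"
  by (rule eq_matI) (auto simp: eccentricity_mat_def ecc_entry_def Let_def)

end

section \<open>Block matrices in the adjacency matrix\<close>

lemma char_poly_fmat_scalar:
  assumes "distinct xs"
  shows "char_poly (fmat xs xs (\<lambda>x y. if x = y then c else 0)) = [:- c, 1 :: 'a :: field_char_0:] ^ length xs"
proof (rule poly_ext)
  fix x :: 'a
  have "x \<cdot>\<^sub>m 1\<^sub>m (length xs) - fmat xs xs (\<lambda>x y. if x = y then c else 0) = (x - c) \<cdot>\<^sub>m 1\<^sub>m (length xs)"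
    using assms by (intro eq_matI) (auto simp: nth_eq_iff_index_eq)
  thus "poly (char_poly (fmat xs xs (\<lambda>x y. if x = y then c else 0))) x = poly ([:- c, 1:] ^ length xs) x"
    by (simp add: poly_char_poly[OF fmat_carrier] poly_power)
qed

text \<open>The characteristic polynomial of the matrix with rows \<open>(2 a, - 2 (a + r))\<close> and
  \<open>(- 2, 3 - 3 (a + r))\<close>, the action of the eccentricity matrix on an eigenvector for \<open>a\<close>.\<close>

definition quad_factor :: "'a \<Rightarrow> 'a \<Rightarrow> 'a :: comm_ring_1 poly" where
  "quad_factor r a = [:- 2 * a, 1:] * [:3 * r - 3 + 3 * a, 1:] - [:4 * (a + r):]"

lemma poly_quad_factor:
  "poly (quad_factor r a) x = (x - 2 * a) * (x - 3 + 3 * r + 3 * a) - 4 * (a + r)"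
  by (simp add: quad_factor_def algebra_simps)

lemma quad_factor_neq_0: "quad_factor r (a :: complex) \<noteq> 0"
proof -
  have "coeff (quad_factor r a) 2 = 1"
    by (simp add: quad_factor_def numeral_2_eq_2)
  thus ?thesis by auto
qed

text \<open>All blocks are polynomials in \<open>A\<close> and therefore commute, so the determinant
  is that of \<open>(x I - 2 A) D - 4 (A + r I)\<close>, with \<open>D\<close> the lower right
  block. This is a quadratic in \<open>A\<close> whose leading coefficient \<open>- 6\<close> is
  nonzero for every \<open>x\<close>.\<close>

lemma det_block_quadratic:
  fixes A :: "complex mat"
  assumes A: "A \<in> carrier_mat n n"
  shows "det (four_block_mat (x \<cdot>\<^sub>m 1\<^sub>m n - 2 \<cdot>\<^sub>m A) (2 \<cdot>\<^sub>m (A + r \<cdot>\<^sub>m 1\<^sub>m n))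
      (2 \<cdot>\<^sub>m 1\<^sub>m n) ((x - 3) \<cdot>\<^sub>m 1\<^sub>m n + 3 \<cdot>\<^sub>m (A + r \<cdot>\<^sub>m 1\<^sub>m n))) =
    (\<Prod>a\<in>#proots (char_poly A). poly (quad_factor r a) x)"
proof -
  define D where "D = (x - 3) \<cdot>\<^sub>m 1\<^sub>m n + 3 \<cdot>\<^sub>m (A + r \<cdot>\<^sub>m 1\<^sub>m n)"
  have D: "D \<in> carrier_mat n n" using A unfolding D_def by auto
  have D': "D = (x - 3 + 3 * r) \<cdot>\<^sub>m 1\<^sub>m n + 3 \<cdot>\<^sub>m A"
    unfolding D_def using A by (intro eq_matI) (auto simp: algebra_simps)
  have "A * D = A * ((x - 3 + 3 * r) \<cdot>\<^sub>m 1\<^sub>m n) + A * (3 \<cdot>\<^sub>m A)"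
    unfolding D' using A by (intro mult_add_distrib_mat) auto
  also have "\<dots> = (x - 3 + 3 * r) \<cdot>\<^sub>m A + 3 \<cdot>\<^sub>m (A * A)"
    using A by (simp add: mult_smult_distrib[of _ n n _ n])
  finally have AD: "A * D = (x - 3 + 3 * r) \<cdot>\<^sub>m A + 3 \<cdot>\<^sub>m (A * A)" .
  have "(x \<cdot>\<^sub>m 1\<^sub>m n - 2 \<cdot>\<^sub>m A) * D = x \<cdot>\<^sub>m 1\<^sub>m n * D - 2 \<cdot>\<^sub>m A * D"
    using A D by (intro minus_mult_distrib_mat) auto
  also have "\<dots> = x \<cdot>\<^sub>m D - 2 \<cdot>\<^sub>m (A * D)"
    using A D by (simp add: mult_smult_assoc_mat[of _ n n _ n])
  finally have 1: "(x \<cdot>\<^sub>m 1\<^sub>m n - 2 \<cdot>\<^sub>m A) * D = x \<cdot>\<^sub>m D - 2 \<cdot>\<^sub>m (A * D)" .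
  have "A + r \<cdot>\<^sub>m 1\<^sub>m n \<in> carrier_mat n n" using A by auto
  hence 2: "2 \<cdot>\<^sub>m (A + r \<cdot>\<^sub>m 1\<^sub>m n) * (2 \<cdot>\<^sub>m 1\<^sub>m n) = 4 \<cdot>\<^sub>m (A + r \<cdot>\<^sub>m 1\<^sub>m n)"
    by (simp add: mult_smult_assoc_mat[of _ n n _ n] mult_smult_distrib[of _ n n _ n], intro eq_matI) auto
  have AA: "A * A \<in> carrier_mat n n" using A by auto
  have "det (four_block_mat (x \<cdot>\<^sub>m 1\<^sub>m n - 2 \<cdot>\<^sub>m A) (2 \<cdot>\<^sub>m (A + r \<cdot>\<^sub>m 1\<^sub>m n)) (2 \<cdot>\<^sub>m 1\<^sub>m n) D) =
      det ((x \<cdot>\<^sub>m 1\<^sub>m n - 2 \<cdot>\<^sub>m A) * D - 2 \<cdot>\<^sub>m (A + r \<cdot>\<^sub>m 1\<^sub>m n) * (2 \<cdot>\<^sub>m 1\<^sub>m n))"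
    using A D by (intro det_four_block_mat)
      (auto simp: mult_smult_assoc_mat[of _ n n _ n] mult_smult_distrib[of _ n n _ n])
  also have "(x \<cdot>\<^sub>m 1\<^sub>m n - 2 \<cdot>\<^sub>m A) * D - 2 \<cdot>\<^sub>m (A + r \<cdot>\<^sub>m 1\<^sub>m n) * (2 \<cdot>\<^sub>m 1\<^sub>m n) =
      (x * (x - 3 + 3 * r) - 4 * r) \<cdot>\<^sub>m 1\<^sub>m n + (x + 2 - 6 * r) \<cdot>\<^sub>m A + (- 6) \<cdot>\<^sub>m (A * A)"
    unfolding 1 2 AD unfolding D' using A AA
    by (intro eq_matI) (auto simp del: index_mult_mat(1) simp add: algebra_simps)
  also have "det \<dots> = (\<Prod>a\<in>#proots (char_poly A).
      (x * (x - 3 + 3 * r) - 4 * r) + (x + 2 - 6 * r) * a + (- 6) * a\<^sup>2)"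
    by (rule det_quadratic_matrix_poly[OF A]) simp
  also have "\<dots> = (\<Prod>a\<in>#proots (char_poly A). poly (quad_factor r a) x)"
    by (simp add: poly_quad_factor algebra_simps power2_eq_square)
  finally show ?thesis unfolding D_def .
qed

lemma sum_image_Inl_Inr:
  assumes "finite A" "finite B"
  shows "sum f (Inl ` A \<union> Inr ` B) = (\<Sum>a\<in>A. f (Inl a)) + (\<Sum>b\<in>B. f (Inr b))"
  using assms by (subst sum.union_disjoint) (auto simp: sum.reindex)

lemma if_1_0_mult:
  "(if P then 1 else 0) * w = (if P then w else (0 :: 'a :: semiring_1))"
  "w * (if P then 1 else 0) = (if P then w else (0 :: 'a :: semiring_1))"
  by auto

text \<open>If \<open>B B\<^sup>T = A + r I\<close>, the pairs \<open>(x, B\<^sup>T y)\<close> span an invariant subspace on which the block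
  matrix acts through a \<open>2 \<times> 2\<close> block matrix in \<open>A\<close>; off it, it acts as the scalar 3.\<close>

lemma char_poly_incidence_block:
  fixes vs :: "'v list" and es :: "'e list" and a :: "'v \<Rightarrow> 'v \<Rightarrow> complex" and b :: "'v \<Rightarrow> 'e \<Rightarrow> complex"
  defines "xs \<equiv> map Inl vs @ map Inr es"
  assumes vs: "distinct vs" and es: "distinct es"
    and bb: "\<And>u v. u \<in> set vs \<Longrightarrow> v \<in> set vs \<Longrightarrow>
      (\<Sum>e\<in>set es. b u e * b v e) = a u v + (if u = v then r else 0)"
    and N11: "\<And>u v. u \<in> set vs \<Longrightarrow> v \<in> set vs \<Longrightarrow> N (Inl u) (Inl v) = 2 * a u v"
    and N12: "\<And>u e. u \<in> set vs \<Longrightarrow> e \<in> set es \<Longrightarrow> N (Inl u) (Inr e) = - 2 * b u e"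
    and N21: "\<And>e u. e \<in> set es \<Longrightarrow> u \<in> set vs \<Longrightarrow> N (Inr e) (Inl u) = - 2 * b u e"
    and N22: "\<And>e f. e \<in> set es \<Longrightarrow> f \<in> set es \<Longrightarrow>
      N (Inr e) (Inr f) = 3 * ((if e = f then 1 else 0) - (\<Sum>u\<in>set vs. b u e * b u f))"
  shows "char_poly (fmat xs xs N) * [:- 3, 1:] ^ length vs =
    [:- 3, 1:] ^ length es * (\<Prod>c\<in>#proots (char_poly (fmat vs vs a)). quad_factor r c)"
proof -
  define ys :: "('v + 'v) list" where "ys = map Inl vs @ map Inr vs"
  define P where "P = (\<lambda>u v. a u v + (if u = v then r else 0))"
  define S :: "'v + 'e \<Rightarrow> 'v + 'v \<Rightarrow> complex" where
    "S = case_sum (\<lambda>u. case_sum (\<lambda>v. if u = v then 1 else 0) (\<lambda>v. 0)) (\<lambda>e. case_sum (\<lambda>v. 0) (\<lambda>v. b v e))"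
  define Q where "Q = case_sum (\<lambda>u. case_sum (\<lambda>v. 2 * a u v) (\<lambda>v. - 2 * P u v))
      (\<lambda>u. case_sum (\<lambda>v. if u = v then - 2 else 0) (\<lambda>v. (if u = v then 3 else 0) - 3 * P u v))"
  \<comment> \<open>\<open>R\<close> is chosen so that \<open>S R\<close> reproduces
    \<open>N\<close> except for the term \<open>3 I\<close> on the edges, while \<open>R S\<close>
    reproduces \<open>Q\<close> except for \<open>3 I\<close> in its second block, by
    \<open>B B^T = P\<close>. The remainders \<open>N'\<close> and \<open>Q'\<close> are thus
    diagonal with entries 0 and 3; the zeros give the same power of \<open>x\<close> on both sides,
    which cancels.\<close>
  define R where "R = case_sum (\<lambda>u. case_sum (\<lambda>v. 2 * a u v) (\<lambda>e. - 2 * b u e))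
      (\<lambda>u. case_sum (\<lambda>v. if u = v then - 2 else 0) (\<lambda>e. - 3 * b u e))"
  define N' :: "'v + 'e \<Rightarrow> 'v + 'e \<Rightarrow> complex" where
    "N' = case_sum (\<lambda>u. (\<lambda>_. 0)) (\<lambda>e. case_sum (\<lambda>_. 0) (\<lambda>f. if e = f then 3 else 0))"
  define Q' :: "'v + 'v \<Rightarrow> 'v + 'v \<Rightarrow> complex" where
    "Q' = case_sum (\<lambda>u. (\<lambda>_. 0)) (\<lambda>u. case_sum (\<lambda>_. 0) (\<lambda>v. if u = v then 3 else 0))"
  have distinct: "distinct xs" "distinct ys"
    using vs es by (auto simp: xs_def ys_def distinct_map inj_on_def)
  have sum_xs: "sum f (set xs) = (\<Sum>v\<in>set vs. f (Inl v)) + (\<Sum>e\<in>set es. f (Inr e))" for f :: "_ \<Rightarrow> complex"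
    by (simp add: xs_def sum_image_Inl_Inr)
  have sum_ys: "sum f (set ys) = (\<Sum>v\<in>set vs. f (Inl v)) + (\<Sum>v\<in>set vs. f (Inr v))" for f :: "_ \<Rightarrow> complex"
    by (simp add: ys_def sum_image_Inl_Inr)
  have bP: "(\<Sum>e\<in>set es. b u e * b v e) = P u v" if "u \<in> set vs" "v \<in> set vs" for u v
    using bb[OF that] by (simp add: P_def)
  have factor: "(\<Sum>x\<in>X. c * f x * g x) = c * (\<Sum>x\<in>X. f x * g x)"
    "(\<Sum>x\<in>X. - (c * f x * g x)) = - c * (\<Sum>x\<in>X. f x * g x)" for c :: complex and f g and X :: "'x set"
    by (simp_all add: sum_distrib_left sum_negf mult.assoc)
  have "char_poly (fmat xs xs N') * char_poly (fmat ys ys Q) = char_poly (fmat xs xs N) * char_poly (fmat ys ys Q')"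
  proof (rule char_poly_fmat_intertwining[OF distinct, of _ S _ _ R])
    fix i c assume i: "i \<in> set xs" and c: "c \<in> set ys"
    show "(\<Sum>j\<in>set xs. N i j * S j c) = (\<Sum>d\<in>set ys. S i d * Q d c)"
    proof (cases i)
      case [simp]: (Inl u)
      hence u: "u \<in> set vs" using i by (auto simp: xs_def)
      show ?thesis
      proof (cases c)
        case [simp]: (Inl v)
        hence "v \<in> set vs" using c by (auto simp: ys_def)
        thus ?thesis using u by (simp add: sum_xs sum_ys S_def Q_def if_1_0_mult N11)
      next
        case [simp]: (Inr v)
        hence "v \<in> set vs" using c by (auto simp: ys_def)
        thus ?thesis using u bP[of u v]
          by (simp add: sum_xs sum_ys S_def Q_def if_1_0_mult N12 factor sum_negf)
      qed
    next
      case [simp]: (Inr e)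
      hence e: "e \<in> set es" using i by (auto simp: xs_def)
      show ?thesis
      proof (cases c)
        case [simp]: (Inl v)
        hence "v \<in> set vs" using c by (auto simp: ys_def)
        thus ?thesis using e
          by (simp add: sum_xs sum_ys S_def Q_def if_1_0_mult N21 if_distrib[of "\<lambda>x. _ * x"] cong: if_cong)
      next
        case [simp]: (Inr v)
        hence v: "v \<in> set vs" using c by (auto simp: ys_def)
        have "(\<Sum>f\<in>set es. N (Inr e) (Inr f) * b v f) =
            (\<Sum>f\<in>set es. if e = f then 3 * b v f else 0) - 3 * (\<Sum>f\<in>set es. \<Sum>u\<in>set vs. b u e * (b u f * b v f))"
          using e by (simp add: N22 left_diff_distrib right_diff_distrib sum_subtractf sum_distrib_left sum_distrib_right
              mult.assoc if_distrib[of "\<lambda>x. x * _"] if_distrib[of "\<lambda>x. _ * x"] cong: if_cong)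
        \<comment> \<open>Exchanging the sums regroups \<open>(B^T B) B^T\<close> as
          \<open>B^T (B B^T)\<close>, which is \<open>B^T P\<close>.\<close>
        also have "(\<Sum>f\<in>set es. \<Sum>u\<in>set vs. b u e * (b u f * b v f)) = (\<Sum>u\<in>set vs. b u e * P u v)"
          by (subst sum.swap) (simp add: sum_distrib_left[symmetric] bP v)
        finally show ?thesis using e v
          by (simp add: sum_xs sum_ys S_def Q_def right_diff_distrib sum_subtractf sum_distrib_left
              if_distrib[of "\<lambda>x. _ * x"] mult_ac cong: if_cong)
      qed
    qed
  next
    fix i j assume i: "i \<in> set xs" and j: "j \<in> set xs"
    show "N' i j = N i j - (\<Sum>d\<in>set ys. S i d * R d j)"
      using i j by (auto simp: xs_def sum_ys N'_def S_def R_def N11 N12 N21 N22 if_1_0_mult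
          if_distrib[of "\<lambda>x. _ * x"] sum_negf sum_distrib_left mult_ac cong: if_cong)
  next
    fix c d assume c: "c \<in> set ys" and d: "d \<in> set ys"
    show "Q' c d = Q c d - (\<Sum>j\<in>set xs. R c j * S j d)"
      using c d by (auto simp: ys_def sum_xs Q'_def S_def R_def Q_def if_1_0_mult bP factor cong: if_cong)
  qed
  moreover have "char_poly (fmat xs xs N') = [:0, 1:] ^ length vs * [:- 3, 1:] ^ length es"
    using char_poly_fmat_scalar[OF vs, of "0 :: complex"] char_poly_fmat_scalar[OF es, of "3 :: complex"]
    unfolding xs_def by (subst char_poly_fmat_append) (auto simp: fmat_map N'_def cong: if_cong)
  moreover have "char_poly (fmat ys ys Q') = [:0, 1:] ^ length vs * [:- 3, 1:] ^ length vs"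
    using char_poly_fmat_scalar[OF vs, of "0 :: complex"] char_poly_fmat_scalar[OF vs, of "3 :: complex"]
    unfolding ys_def by (subst char_poly_fmat_append) (auto simp: fmat_map Q'_def cong: if_cong)
  ultimately have 1: "char_poly (fmat xs xs N) * [:- 3, 1:] ^ length vs =
      [:- 3, 1:] ^ length es * char_poly (fmat ys ys Q)"
    by (simp add: ac_simps)
  have "char_poly (fmat ys ys Q) = (\<Prod>c\<in>#proots (char_poly (fmat vs vs a)). quad_factor r c)"
  proof (rule poly_ext)
    fix x :: complex
    let ?n = "length vs"
    let ?A = "fmat vs vs a"
    have "x \<cdot>\<^sub>m 1\<^sub>m (?n + ?n) - fmat ys ys Q =
        four_block_mat (x \<cdot>\<^sub>m 1\<^sub>m ?n - 2 \<cdot>\<^sub>m ?A) (2 \<cdot>\<^sub>m (?A + r \<cdot>\<^sub>m 1\<^sub>m ?n))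
          (2 \<cdot>\<^sub>m 1\<^sub>m ?n) ((x - 3) \<cdot>\<^sub>m 1\<^sub>m ?n + 3 \<cdot>\<^sub>m (?A + r \<cdot>\<^sub>m 1\<^sub>m ?n))"
      unfolding ys_def fmat_append fmat_map using vs
      by (intro eq_matI) (auto simp: Q_def P_def nth_eq_iff_index_eq algebra_simps)
    moreover have "fmat ys ys Q \<in> carrier_mat (?n + ?n) (?n + ?n)"
      using fmat_carrier[of ys ys Q] by (simp add: ys_def)
    ultimately show "poly (char_poly (fmat ys ys Q)) x =
        poly (\<Prod>c\<in>#proots (char_poly ?A). quad_factor r c) x"
      by (simp add: poly_char_poly[of _ "?n + ?n"] det_block_quadratic poly_prod_mset)
  qed
  thus ?thesis using 1 by simp
qed

lemma det_fmat_2: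
  fixes f :: "'i \<Rightarrow> 'i \<Rightarrow> 'a :: idom"
  shows "det (fmat [i, j] [i, j] f) = f i i * f j j - f i j * f j i"
proof -
  have carrier: "fmat [k] [l] f \<in> carrier_mat 1 1" for k l
    using fmat_carrier[of "[k]" "[l]" f] by simp
  have mult: "fmat [k] [l] f * fmat [k'] [l'] f = fmat [k] [l'] (\<lambda>_ _. f k l * f k' l')" for k l k' l'
    by (rule eq_matI) (auto simp: scalar_prod_def)
  have "fmat [i, j] [i, j] f = four_block_mat (fmat [i] [i] f) (fmat [i] [j] f) (fmat [j] [i] f) (fmat [j] [j] f)"
    using fmat_append[of "[i]" "[j]" "[i]" "[j]" f] by simp
  also have "det \<dots> = det (fmat [i] [i] f * fmat [j] [j] f - fmat [i] [j] f * fmat [j] [i] f)"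
    by (rule det_four_block_mat[OF carrier carrier carrier carrier])
      (simp only: mult, rule eq_matI, auto)
  also have "\<dots> = det (fmat [i] [j] (\<lambda>_ _. f i i * f j j - f i j * f j i))"
    unfolding mult by (rule arg_cong[of _ _ det], rule eq_matI) auto
  also have "\<dots> = f i i * f j j - f i j * f j i"
    using fmat_carrier[of "[i]" "[j]"] by (subst det_single) auto
  finally show ?thesis .
qed

lemma char_poly_fmat_2:
  fixes f :: "'i \<Rightarrow> 'i \<Rightarrow> 'a :: field_char_0"
  assumes "i \<noteq> j"
  shows "char_poly (fmat [i, j] [i, j] f) = [:- f i i, 1:] * [:- f j j, 1:] - [:f i j * f j i:]"
proof (rule poly_ext)
  fix x :: 'a
  have "x \<cdot>\<^sub>m 1\<^sub>m (length [i, j]) - fmat [i, j] [i, j] f =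
      fmat [i, j] [i, j] (\<lambda>k l. (if k = l then x else 0) - f k l)"
    using assms by (intro eq_matI) (auto simp: less_Suc_eq)
  hence "poly (char_poly (fmat [i, j] [i, j] f)) x = det (fmat [i, j] [i, j] (\<lambda>k l. (if k = l then x else 0) - f k l))"
    by (simp only: poly_char_poly[OF fmat_carrier])
  thus "poly (char_poly (fmat [i, j] [i, j] f)) x = poly ([:- f i i, 1:] * [:- f j j, 1:] - [:f i j * f j i:]) x"
    unfolding det_fmat_2 using assms by (simp add: algebra_simps)
qed

lemma char_poly_linear_image:
  fixes A :: "complex mat"
  assumes A: "A \<in> carrier_mat n n" and "c \<noteq> 0"
  shows "char_poly (b \<cdot>\<^sub>m 1\<^sub>m n + c \<cdot>\<^sub>m A) = (\<Prod>a\<in>#proots (char_poly A). [:- (b + c * a), 1:])"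
proof (rule poly_ext)
  fix x :: complex
  have "x \<cdot>\<^sub>m 1\<^sub>m n - (b \<cdot>\<^sub>m 1\<^sub>m n + c \<cdot>\<^sub>m A) = (x - b) \<cdot>\<^sub>m 1\<^sub>m n + (- c) \<cdot>\<^sub>m A"
    using A by (intro eq_matI) auto
  hence "poly (char_poly (b \<cdot>\<^sub>m 1\<^sub>m n + c \<cdot>\<^sub>m A)) x = (\<Prod>a\<in>#proots (char_poly A). x - b + - c * a)"
    using A det_linear_matrix_poly[OF A, of "- c" "x - b"] \<open>c \<noteq> 0\<close>
    by (simp add: poly_char_poly[of _ n])
  thus "poly (char_poly (b \<cdot>\<^sub>m 1\<^sub>m n + c \<cdot>\<^sub>m A)) x = poly (\<Prod>a\<in>#proots (char_poly A). [:- (b + c * a), 1:]) x"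
    by (simp add: poly_prod_mset algebra_simps)
qed

text \<open>Compare both sides of \<open>A v = k v\<close> at a coordinate \<open>i\<close> where
  the modulus of \<open>v\<close> is maximal, and divide by that modulus.\<close>

lemma norm_eigenvalue_le:
  fixes A :: "complex mat"
  assumes A: "A \<in> carrier_mat n n" and k: "k \<in># proots (char_poly A)"
    and rows: "\<And>i. i < n \<Longrightarrow> (\<Sum>j = 0..<n. norm (A $$ (i, j))) \<le> s"
  shows "norm k \<le> s"
proof -
  have "char_poly A \<noteq> 0" using degree_monic_char_poly[OF A] by auto
  hence "eigenvalue A k" using k eigenvalue_root_char_poly[OF A] by simp
  then obtain v where v: "v \<in> carrier_vec n" "v \<noteq> 0\<^sub>v n" and Av: "A *\<^sub>v v = k \<cdot>\<^sub>v v"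
    using A by (auto simp: eigenvalue_def eigenvector_def)
  obtain l where l: "l < n" "v $ l \<noteq> 0" using v by (metis carrier_vecD eq_vecI index_zero_vec)
  obtain i where i: "i < n" and max: "\<And>j. j < n \<Longrightarrow> norm (v $ j) \<le> norm (v $ i)"
  proof -
    let ?V = "(\<lambda>j. norm (v $ j)) ` {..<n}"
    have "Max ?V \<in> ?V" using l by (intro Max_in) auto
    then obtain i where "i < n" "norm (v $ i) = Max ?V" by auto
    thus ?thesis using that by simp
  qed
  have "0 < norm (v $ l)" using l by simp
  also have "\<dots> \<le> norm (v $ i)" using l max by blast
  finally have "norm (v $ i) > 0" .
  have "norm k * norm (v $ i) = norm ((A *\<^sub>v v) $ i)"
    using i v by (simp add: Av norm_mult)
  also have "\<dots> = norm (\<Sum>j = 0..<n. A $$ (i, j) * v $ j)"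
    using i v A by (simp add: scalar_prod_def)
  also have "\<dots> \<le> (\<Sum>j = 0..<n. norm (A $$ (i, j)) * norm (v $ i))"
    using max by (intro sum_norm_le) (auto simp: norm_mult intro: mult_left_mono)
  also have "\<dots> = (\<Sum>j = 0..<n. norm (A $$ (i, j))) * norm (v $ i)" by (simp add: sum_distrib_right)
  also have "\<dots> \<le> s * norm (v $ i)" using rows[OF i] by (intro mult_right_mono) auto
  finally show ?thesis using \<open>norm (v $ i) > 0\<close> by simp
qed

section \<open>Incidence sums\<close>

definition adj :: "'a ugraph \<Rightarrow> 'a \<Rightarrow> 'a \<Rightarrow> complex" where
  "adj G u v = (if adjacent G u v then 1 else 0)"

definition inc :: "'a \<Rightarrow> 'a set \<Rightarrow> complex" where
  "inc u e = (if u \<in> e then 1 else 0)"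

lemma adjacency_mat_complex: "map_mat complex_of_real (adjacency_mat G vs) = fmat vs vs (adj G)"
  by (rule eq_matI) (auto simp: adjacency_mat_def adj_def)

lemma sum_if_card: "finite A \<Longrightarrow> (\<Sum>x\<in>A. if P x then 1 else (0 :: 'a :: semiring_1)) = of_nat (card {x \<in> A. P x})"
  by (simp add: sum.If_cases Int_def)

lemma sum_adj:
  assumes "simple_graph G" "regular_graph r G" "u \<in> verts G"
  shows "(\<Sum>v\<in>verts G. adj G u v) = of_nat r"
  using assms by (simp add: adj_def sum_if_card simple_graph_def regular_graph_def)

lemma card_incident_edges:
  assumes "simple_graph G" "regular_graph r G" "u \<in> verts G"
  shows "card {e \<in> edges G. u \<in> e} = r"
proof -
  have "{e \<in> edges G. u \<in> e} = (\<lambda>v. {u, v}) ` {v \<in> verts G. adjacent G u v}"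
  proof (intro equalityI subsetI)
    fix e assume "e \<in> {e \<in> edges G. u \<in> e}"
    then obtain v where "e = {u, v}" "adjacent G u v" "v \<in> verts G"
      using incident_edgeE[OF assms(1), of e u] by auto
    thus "e \<in> (\<lambda>v. {u, v}) ` {v \<in> verts G. adjacent G u v}" by blast
  qed (auto simp: adjacent_def)
  moreover have "inj_on (\<lambda>v. {u, v}) {v \<in> verts G. adjacent G u v}"
    by (auto simp: inj_on_def doubleton_eq_iff)
  ultimately show ?thesis using assms by (simp add: card_image regular_graph_def)
qed

lemma sum_inc_edges:
  assumes "simple_graph G" "regular_graph r G" "u \<in> verts G"
  shows "(\<Sum>e\<in>edges G. inc u e) = of_nat r"
  using simple_graph_finite_edges[OF assms(1)] card_incident_edges[OF assms]
  by (simp add: inc_def sum_if_card)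

lemma sum_inc_verts:
  assumes "simple_graph G" "e \<in> edges G"
  shows "(\<Sum>u\<in>verts G. inc u e) = 2"
proof -
  have "{u \<in> verts G. u \<in> e} = e" "card e = 2" "finite (verts G)"
    using assms by (auto simp: simple_graph_def)
  thus ?thesis by (simp add: inc_def sum_if_card)
qed

text \<open>The identity \<open>B B^T = A + r I\<close>: each vertex lies on \<open>r\<close> edges,
  and two distinct vertices share an edge, then only one, exactly when they are adjacent.\<close>

lemma sum_inc_inc_edges:
  assumes "simple_graph G" "regular_graph r G" "u \<in> verts G" "v \<in> verts G"
  shows "(\<Sum>e\<in>edges G. inc u e * inc v e) = adj G u v + (if u = v then of_nat r else 0)"
proof -
  have fin: "finite (edges G)" using simple_graph_finite_edges[OF assms(1)] .
  have "(\<Sum>e\<in>edges G. inc u e * inc v e) = (\<Sum>e\<in>edges G. if u \<in> e \<and> v \<in> e then 1 else 0)"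
    by (intro sum.cong) (auto simp: inc_def)
  also have "\<dots> = of_nat (card {e \<in> edges G. u \<in> e \<and> v \<in> e})" using fin by (rule sum_if_card)
  also have "\<dots> = adj G u v + (if u = v then of_nat r else 0)"
  proof (cases "u = v")
    case True
    thus ?thesis using card_incident_edges[OF assms(1-3)] simple_graph_not_adjacent_self[OF assms(1)]
      by (simp add: adj_def)
  next
    case False
    have "{e \<in> edges G. u \<in> e \<and> v \<in> e} = (if adjacent G u v then {{u, v}} else {})"
    proof -
      have "e = {u, v}" if e: "e \<in> edges G" "u \<in> e" "v \<in> e" for e
      proof -
        obtain w where "e = {u, w}" using incident_edgeE[OF assms(1) e(1,2)] by blast
        thus ?thesis using e(3) False by auto
      qed
      hence "{e \<in> edges G. u \<in> e \<and> v \<in> e} = {e \<in> edges G. e = {u, v}}" by blast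
      also have "\<dots> = (if adjacent G u v then {{u, v}} else {})" by (auto simp: adjacent_def)
      finally show ?thesis .
    qed
    thus ?thesis using False by (simp add: adj_def)
  qed
  finally show ?thesis .
qed

lemma sum_inc_inc_verts:
  assumes "simple_graph G" "e \<in> edges G" "f \<in> edges G"
  shows "(\<Sum>u\<in>verts G. inc u e * inc u f) = of_nat (card (e \<inter> f))"
proof -
  have "(\<Sum>u\<in>verts G. inc u e * inc u f) = (\<Sum>u\<in>verts G. if u \<in> e \<and> u \<in> f then 1 else 0)"
    by (intro sum.cong) (auto simp: inc_def)
  also have "\<dots> = of_nat (card {u \<in> verts G. u \<in> e \<and> u \<in> f})"
    using assms by (intro sum_if_card) (auto simp: simple_graph_def)
  also have "{u \<in> verts G. u \<in> e \<and> u \<in> f} = e \<inter> f" using assms by (auto simp: simple_graph_def)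
  finally show ?thesis .
qed

lemma card_edge_Int:
  assumes "simple_graph G" "e \<in> edges G" "f \<in> edges G"
  shows "card (e \<inter> f) = (if e \<inter> f = {} then 0 else if e = f then 2 else 1)"
proof -
  have e: "finite e" "card e = 2" and f: "finite f" "card f = 2"
    using assms by (auto simp: simple_graph_def intro: card_ge_0_finite)
  show ?thesis
  proof (cases "e \<inter> f = {} \<or> e = f")
    case False
    hence "e \<inter> f \<noteq> e" using e f card_subset_eq[of f e] by auto
    hence "card (e \<inter> f) < 2" using psubset_card_mono[of e "e \<inter> f"] e by auto
    moreover have "card (e \<inter> f) > 0" using False e by (simp add: card_gt_0_iff)
    ultimately show ?thesis using False by simp
  qed (use e in auto)
qed

text \<open>The rows of the adjacency matrix sum to \<open>r\<close>, which bounds the spectrum. The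
  bound makes the radicand in \<open>t_1\<close> and \<open>t_2\<close> nonnegative.\<close>

lemma adjacency_eigenvalue_ge:
  assumes "simple_graph G" "regular_graph r G" "distinct vs" "set vs = verts G"
    and "complex_of_real c \<in># proots (char_poly (fmat vs vs (adj G)))"
  shows "c \<ge> - real r"
proof -
  have "norm (complex_of_real c) \<le> real r"
  proof (rule norm_eigenvalue_le[OF fmat_carrier assms(5)])
    fix i assume i: "i < length vs"
    have "(\<Sum>j = 0..<length vs. norm (fmat vs vs (adj G) $$ (i, j))) =
        (\<Sum>j = 0..<length vs. if adjacent G (vs ! i) (vs ! j) then 1 else 0)"
      using i by (intro sum.cong) (auto simp: adj_def)
    also have "\<dots> = (\<Sum>v\<in>verts G. if adjacent G (vs ! i) v then 1 else 0)"
      using sum_nth_distinct[OF assms(3), of "\<lambda>v. if adjacent G (vs ! i) v then 1 else 0 :: real"] assms(4) by simp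
    also have "\<dots> = real r"
      using assms i nth_mem[OF i] by (simp add: sum_if_card simple_graph_def regular_graph_def)
    finally show "(\<Sum>j = 0..<length vs. norm (fmat vs vs (adj G) $$ (i, j))) \<le> real r" by simp
  qed
  thus ?thesis by simp
qed

lemma regular_connected_degree_pos:
  assumes "simple_graph G" "connected_graph G" "regular_graph r G" "card (verts G) \<ge> 2"
  shows "r > 0"
proof -
  obtain u v where uv: "u \<in> verts G" "v \<in> verts G" "u \<noteq> v"
    using assms(4) card_le_Suc0_iff_eq[of "verts G"] assms(1)
    by (auto simp: simple_graph_def not_le[symmetric])
  then obtain xs where xs: "walk_betw G u xs v" using assms(2) by (auto simp: connected_graph_def)
  hence "walk_len G (length xs - 1) u v" unfolding walk_len_def
    by (intro exI[of _ xs]) (auto simp: walk_betw_def)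
  then obtain w where "adjacent G u w"
    using uv by (cases "length xs - 1") (auto simp: walk_len_0 walk_len_Suc)
  hence "w \<in> {w \<in> verts G. adjacent G u w}" using simple_graph_adjacentD[OF assms(1)] by blast
  moreover have "finite {w \<in> verts G. adjacent G u w}" using assms(1) by (auto simp: simple_graph_def)
  ultimately have "card {w \<in> verts G. adjacent G u w} > 0" by (auto simp: card_gt_0_iff)
  thus ?thesis using assms(3) uv by (auto simp: regular_graph_def)
qed

section \<open>The quotient matrix\<close>

context central_join
begin

text \<open>\<open>cls\<close> numbers the three vertex classes. \<open>quot\<close> is the quotient matrix of the statement,
  \<open>corr\<close> holds the coefficients of the all-ones blocks, and \<open>reduced\<close> is the quotient left after
  these blocks are subtracted.\<close>

definition cls :: "('a + 'a set) + 'b \<Rightarrow> nat" where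
  "cls = case_sum (case_sum (\<lambda>_. 0) (\<lambda>_. 1)) (\<lambda>_. 2)"

definition quot :: "nat \<Rightarrow> nat \<Rightarrow> nat \<Rightarrow> nat \<Rightarrow> nat \<Rightarrow> nat \<Rightarrow> complex" where
  "quot p q n s c d =
    [[2 * of_nat r, 2 * (of_nat q - of_nat r), 0],
     [2 * (of_nat p - 2), 3 * (of_nat q - 2 * of_nat r + 1), 2 * of_nat n],
     [0, 2 * of_nat q, 2 * (of_nat n - 1 - of_nat s)]] ! c ! d"

definition corr :: "nat \<Rightarrow> nat \<Rightarrow> complex" where
  "corr c d = [[0, 2, 0], [2, 3, 2], [0, 2, 2]] ! c ! d"

definition reduced :: "nat \<Rightarrow> nat \<Rightarrow> nat \<Rightarrow> complex" where
  "reduced s c d =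
    [[2 * of_nat r, - 2 * of_nat r, 0], [- 4, 3 * (1 - 2 * of_nat r), 0], [0, 0, - 2 * (1 + of_nat s)]] ! c ! d"

text \<open>On class-constant vectors only the eigenvalues \<open>r\<close> of \<open>G\<close> and
  \<open>s\<close> of \<open>H\<close> are visible, so their factors appear. The off-diagonal
  entries \<open>- 2 r\<close> and \<open>- 4\<close> replace \<open>- 4 r\<close> and
  \<open>- 2\<close> because \<open>B^T\<close> maps the all-ones vector to twice the all-ones
  vector; their product is unchanged.\<close>

lemma char_poly_reduced:
  "char_poly (fmat [0, 1, 2] [0, 1, 2] (reduced s)) = quad_factor (of_nat r) (of_nat r) * [:2 * (1 + of_nat s), 1:]"
proof -
  have "char_poly (fmat ([0, 1] @ [2]) ([0, 1] @ [2]) (reduced s)) =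
      char_poly (fmat [0, 1] [0, 1] (reduced s)) * char_poly (fmat [2] [2] (reduced s))"
    by (rule char_poly_fmat_append) (auto simp: reduced_def)
  also have "char_poly (fmat [0, 1] [0, 1] (reduced s)) = quad_factor (of_nat r) (of_nat r)"
    by (subst char_poly_fmat_2) (simp_all add: quad_factor_def reduced_def algebra_simps)
  also have "fmat [2] [2] (reduced s) = fmat [2] [2 :: nat] (\<lambda>x y. if x = y then reduced s 2 2 else 0)"
    by (rule fmat_cong) auto
  also have "char_poly \<dots> = [:- reduced s 2 2, 1:]"
    by (subst char_poly_fmat_scalar) auto
  also have "- reduced s 2 2 = 2 * (1 + of_nat s)" by (simp add: reduced_def)
  finally show ?thesis by (simp only: append_Cons append_Nil)
qed

text \<open>The sum counts the common ends of \<open>e\<close> and \<open>f\<close>, which number 2,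
  1 or 0 for equal, meeting or disjoint edges; the formula then gives 0, 0 and 3.\<close>

lemma ecc_entry_mid_mid_inc:
  assumes "e \<in> edges G" "f \<in> edges G"
  shows "complex_of_real (ecc_entry (mid e) (mid f)) =
    3 + 3 * ((if e = f then 1 else 0) - (\<Sum>u\<in>verts G. inc u e * inc u f))"
proof -
  have "e \<noteq> {}" using assms simple_G by (auto simp: simple_graph_def)
  thus ?thesis
    using assms by (auto simp: ecc_entry_mid_mid sum_inc_inc_verts[OF simple_G] card_edge_Int[OF simple_G])
qed

lemma ecc_entry_vtx_vtx_adj:
  "u \<in> verts G \<Longrightarrow> v \<in> verts G \<Longrightarrow> complex_of_real (ecc_entry (vtx u) (vtx v)) = 2 * adj G u v"
  by (simp add: ecc_entry_vtx_vtx adj_def)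

lemma ecc_entry_vtx_mid_inc:
  "u \<in> verts G \<Longrightarrow> e \<in> edges G \<Longrightarrow> complex_of_real (ecc_entry (vtx u) (mid e)) = 2 - 2 * inc u e"
  by (simp add: ecc_entry_vtx_mid inc_def)

lemma ecc_entry_mid_vtx_inc:
  "u \<in> verts G \<Longrightarrow> e \<in> edges G \<Longrightarrow> complex_of_real (ecc_entry (mid e) (vtx u)) = 2 - 2 * inc u e"
  using ecc_entry_vtx_mid_inc ecc_entry_commute by metis

lemma ecc_entry_new_new_adj:
  "w \<in> verts H \<Longrightarrow> z \<in> verts H \<Longrightarrow>
    complex_of_real (ecc_entry (new w) (new z)) = 2 - 2 * ((if w = z then 1 else 0) + adj H w z)"
  using simple_graph_not_adjacent_self[OF simple_H] by (auto simp: ecc_entry_new_new adj_def)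

lemma ecc_entry_new_vtx:
  "u \<in> verts G \<Longrightarrow> w \<in> verts H \<Longrightarrow> ecc_entry (new w) (vtx u) = 0"
  using ecc_entry_vtx_new ecc_entry_commute by metis

lemma ecc_entry_new_mid:
  "e \<in> edges G \<Longrightarrow> w \<in> verts H \<Longrightarrow> ecc_entry (new w) (mid e) = 2"
  using ecc_entry_mid_new ecc_entry_commute by metis

lemmas ecc_entries = ecc_entry_mid_mid_inc ecc_entry_vtx_vtx_adj ecc_entry_vtx_mid_inc ecc_entry_mid_vtx_inc
  ecc_entry_new_new_adj ecc_entry_new_vtx ecc_entry_new_mid ecc_entry_vtx_new ecc_entry_mid_new

text \<open>After the subtraction nothing couples \<open>H\<close> to the rest, and the part on
  \<open>G\<close> has exactly the blocks required by
  \<open>char_poly_incidence_block\<close>.\<close>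

definition core :: "('a + 'a set) + 'b \<Rightarrow> ('a + 'a set) + 'b \<Rightarrow> complex" where
  "core i j = complex_of_real (ecc_entry i j) - corr (cls i) (cls j)"

text \<open>These sums depend only on the classes involved, so the partition is equitable; this is
  the intertwining of the eccentricity matrix with \<open>quot\<close>.\<close>

lemma row_sums:
  assumes "regular_graph s H"
  shows "u \<in> verts G \<Longrightarrow> (\<Sum>v\<in>verts G. complex_of_real (ecc_entry (vtx u) (vtx v))) = 2 * of_nat r"
    "u \<in> verts G \<Longrightarrow> (\<Sum>e\<in>edges G. complex_of_real (ecc_entry (vtx u) (mid e))) =
      2 * (of_nat (card (edges G)) - of_nat r)"
    "u \<in> verts G \<Longrightarrow> (\<Sum>w\<in>verts H. complex_of_real (ecc_entry (vtx u) (new w))) = 0"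
    "e \<in> edges G \<Longrightarrow> (\<Sum>u\<in>verts G. complex_of_real (ecc_entry (mid e) (vtx u))) =
      2 * (of_nat (card (verts G)) - 2)"
    "e \<in> edges G \<Longrightarrow> (\<Sum>f\<in>edges G. complex_of_real (ecc_entry (mid e) (mid f))) =
      3 * (of_nat (card (edges G)) - 2 * of_nat r + 1)"
    "e \<in> edges G \<Longrightarrow> (\<Sum>w\<in>verts H. complex_of_real (ecc_entry (mid e) (new w))) = 2 * of_nat (card (verts H))"
    "w \<in> verts H \<Longrightarrow> (\<Sum>u\<in>verts G. complex_of_real (ecc_entry (new w) (vtx u))) = 0"
    "w \<in> verts H \<Longrightarrow> (\<Sum>e\<in>edges G. complex_of_real (ecc_entry (new w) (mid e))) = 2 * of_nat (card (edges G))"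
    "w \<in> verts H \<Longrightarrow> (\<Sum>z\<in>verts H. complex_of_real (ecc_entry (new w) (new z))) =
      2 * (of_nat (card (verts H)) - 1 - of_nat s)"
proof -
  assume e: "e \<in> edges G"
  \<comment> \<open>Row sum of \<open>B^T B\<close>: each of the two ends of \<open>e\<close> lies
    on \<open>r\<close> edges.\<close>
  have "(\<Sum>f\<in>edges G. \<Sum>u\<in>verts G. inc u e * inc u f) = (\<Sum>u\<in>verts G. inc u e * of_nat r)"
    by (subst sum.swap) (simp add: sum_distrib_left[symmetric] sum_inc_edges[OF simple_G regular_G])
  also have "\<dots> = 2 * of_nat r"
    by (simp add: sum_distrib_right[symmetric] sum_inc_verts[OF simple_G e])
  finally show "(\<Sum>f\<in>edges G. complex_of_real (ecc_entry (mid e) (mid f))) =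
      3 * (of_nat (card (edges G)) - 2 * of_nat r + 1)"
    using e finite_edges_G
    by (simp add: ecc_entries sum.distrib sum_subtractf sum_distrib_left[symmetric] algebra_simps)
qed (simp_all add: ecc_entries sum.distrib sum_subtractf sum_distrib_left[symmetric] sum_adj[OF simple_G regular_G]
    sum_inc_edges[OF simple_G regular_G] sum_inc_verts[OF simple_G] finite_verts_G finite_verts_H finite_edges_G
    sum_adj[OF simple_H assms] sum_distrib_right[symmetric] algebra_simps)

lemma char_poly_eccentricity_core:
  assumes vs: "distinct vs" "set vs = verts G" and es: "distinct es" "set es = edges G"
    and ws: "distinct ws" "set ws = verts H" and s: "regular_graph s H"
    and ord: "distinct xs" "set xs = verts J"
  shows "char_poly (fmat xs xs core) *
      char_poly (fmat [0, 1, 2] [0, 1, 2] (quot (length vs) (length es) (length ws) s)) =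
    char_poly (fmat xs xs (\<lambda>i j. complex_of_real (ecc_entry i j))) *
      char_poly (fmat [0, 1, 2] [0, 1, 2] (reduced s))"
proof -
  have card: "card (verts G) = length vs" "card (edges G) = length es" "card (verts H) = length ws"
    using vs es ws distinct_card by metis+
  have fin: "finite (verts G)" "finite (edges G)" "finite (verts H)"
    using finite_verts_G finite_edges_G finite_verts_H .
  have sum_xs: "sum f (set xs) = (\<Sum>u\<in>verts G. f (vtx u)) + (\<Sum>e\<in>edges G. f (mid e)) + (\<Sum>w\<in>verts H. f (new w))"
    for f :: "_ \<Rightarrow> complex"
  proof -
    have "set xs = Inl ` (Inl ` verts G \<union> Inr ` edges G) \<union> Inr ` verts H" by (auto simp: ord(2))
    thus ?thesis using fin by (simp only: sum_image_Inl_Inr finite_imageI finite_UnI)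
  qed
  have xs_cases: "(\<exists>u\<in>verts G. i = vtx u) \<or> (\<exists>e\<in>edges G. i = mid e) \<or> (\<exists>w\<in>verts H. i = new w)"
    if "i \<in> set xs" for i using that by (auto simp: ord(2))
  show ?thesis
  \<comment> \<open>Here \<open>S\<close> is the class indicator matrix and \<open>R\<close> spreads
    \<open>corr\<close> over the classes. Thus \<open>S R\<close> is the blockwise constant matrix,
    and \<open>R S\<close> is \<open>corr\<close> with its columns scaled by the class
    sizes.\<close>
  proof (rule char_poly_fmat_intertwining[of _ _ _ "\<lambda>i c. if cls i = c then 1 else 0" _ _ "\<lambda>d j. corr d (cls j)"])
    fix i c assume "i \<in> set xs" "c \<in> set [0, 1, 2 :: nat]"
    hence c: "c = 0 \<or> c = 1 \<or> c = 2" by auto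
    show "(\<Sum>j\<in>set xs. complex_of_real (ecc_entry i j) * (if cls j = c then 1 else 0)) =
        (\<Sum>d\<in>set [0, 1, 2]. (if cls i = d then 1 else 0) * quot (length vs) (length es) (length ws) s d c)"
      using xs_cases[OF \<open>i \<in> set xs\<close>] c
      by (elim disjE bexE) (simp_all add: sum_xs cls_def quot_def row_sums[OF s] card)
  next
    fix i j assume i: "i \<in> set xs" and j: "j \<in> set xs"
    show "core i j = complex_of_real (ecc_entry i j) -
        (\<Sum>d\<in>set [0, 1, 2]. (if cls i = d then 1 else 0) * corr d (cls j))"
      using xs_cases[OF i] by (elim disjE bexE) (simp_all add: core_def cls_def)
  next
    fix c d assume "c \<in> set [0, 1, 2 :: nat]" "d \<in> set [0, 1, 2 :: nat]"
    hence "c = 0 \<or> c = 1 \<or> c = 2" "d = 0 \<or> d = 1 \<or> d = 2" by auto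
    thus "reduced s c d = quot (length vs) (length es) (length ws) s c d -
        (\<Sum>j\<in>set xs. corr c (cls j) * (if cls j = d then 1 else 0))"
      by (elim disjE) (simp_all add: sum_xs reduced_def quot_def corr_def cls_def card algebra_simps)
  qed (use ord in auto)
qed

text \<open>The power of \<open>x - 3\<close> stays on the left because there may be fewer edges
  than vertices, so that it does not divide out of the right-hand power.\<close>

lemma char_poly_core:
  assumes vs: "distinct vs" "set vs = verts G" and es: "distinct es" "set es = edges G"
    and ws: "distinct ws" "set ws = verts H" and ord: "distinct xs" "set xs = verts J"
  shows "char_poly (fmat xs xs core) * [:- 3, 1:] ^ length vs =
    [:- 3, 1:] ^ length es * (\<Prod>a\<in>#proots (char_poly (fmat vs vs (adj G))). quad_factor (of_nat r) a) *
      (\<Prod>a\<in>#proots (char_poly (fmat ws ws (adj H))). [:2 * (1 + a), 1:])"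
proof -
  let ?N = "map Inl vs @ map Inr es"
  have "char_poly (fmat xs xs core) = char_poly (fmat (map Inl ?N @ map Inr ws) (map Inl ?N @ map Inr ws) core)"
  proof (rule char_poly_fmat_reorder[OF ord(1)])
    show "distinct (map Inl ?N @ map Inr ws)" using vs es ws by (auto simp: distinct_map inj_on_def)
    show "set xs = set (map Inl ?N @ map Inr ws)" using vs es ws by (auto simp: ord(2))
  qed
  also have "\<dots> = char_poly (fmat ?N ?N (\<lambda>i j. core (Inl i) (Inl j))) * char_poly (fmat ws ws (\<lambda>w z. core (Inr w) (Inr z)))"
  proof (subst char_poly_fmat_append)
    show "core x y = 0" if "x \<in> set (map Inl ?N)" "y \<in> set (map Inr ws)" for x y
      using that vs es ws by (auto simp: core_def corr_def cls_def ecc_entries)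
  qed (simp only: fmat_map)
  finally have 1: "char_poly (fmat xs xs core) =
      char_poly (fmat ?N ?N (\<lambda>i j. core (Inl i) (Inl j))) * char_poly (fmat ws ws (\<lambda>w z. core (Inr w) (Inr z)))" .
  have "ws ! i \<in> verts H" if "i < length ws" for i using nth_mem[OF that] ws by simp
  hence "fmat ws ws (\<lambda>w z. core (Inr w) (Inr z)) = (- 2) \<cdot>\<^sub>m 1\<^sub>m (length ws) + (- 2) \<cdot>\<^sub>m fmat ws ws (adj H)"
    using ws by (intro eq_matI) (auto simp: core_def corr_def cls_def ecc_entries nth_eq_iff_index_eq)
  hence 2: "char_poly (fmat ws ws (\<lambda>w z. core (Inr w) (Inr z))) =
      (\<Prod>a\<in>#proots (char_poly (fmat ws ws (adj H))). [:2 * (1 + a), 1:])"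
    using char_poly_linear_image[OF fmat_carrier[of ws ws "adj H"], where b = "- 2" and c = "- 2"] by (simp add: algebra_simps)
  have 3: "char_poly (fmat ?N ?N (\<lambda>i j. core (Inl i) (Inl j))) * [:- 3, 1:] ^ length vs =
      [:- 3, 1:] ^ length es * (\<Prod>a\<in>#proots (char_poly (fmat vs vs (adj G))). quad_factor (of_nat r) a)"
    by (rule char_poly_incidence_block[where b = inc])
      (use vs es in \<open>auto simp: core_def corr_def cls_def ecc_entries sum_inc_inc_edges[OF simple_G regular_G]\<close>)
  have "char_poly (fmat xs xs core) * [:- 3, 1:] ^ length vs =
      char_poly (fmat ?N ?N (\<lambda>i j. core (Inl i) (Inl j))) * [:- 3, 1:] ^ length vs *
      (\<Prod>a\<in>#proots (char_poly (fmat ws ws (adj H))). [:2 * (1 + a), 1:])"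
    unfolding 1 2 by (simp only: ac_simps)
  thus ?thesis unfolding 3 .
qed

end

section \<open>The spectrum\<close>

text \<open>Both sides are monic quadratics, so it suffices to match the sum and product of the
  roots. The bound on \<open>l\<close> makes the radicand nonnegative, hence \<open>d\<close>
  squares back to it.\<close>

lemma quad_factor_split:
  fixes l s :: real
  assumes "l \<ge> - s"
  defines "d \<equiv> sqrt ((3 * (s - 1) + 5 * l)\<^sup>2 + 16 * (l + s))"
  shows "quad_factor (complex_of_real s) (complex_of_real l) =
    [:- complex_of_real (- (2 * ((- (3 * (s - 1) + 5 * l) + d) / 4) + 3 * (l + s - 1))), 1:] *
    [:- complex_of_real (- (2 * ((- (3 * (s - 1) + 5 * l) - d) / 4) + 3 * (l + s - 1))), 1:]"
proof -
  \<comment> \<open>Origin of \<open>t\<close>: if \<open>(t, 1)\<close> is an eigenvector of the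
    matrix with rows \<open>(2 l, - 2 (l + s))\<close> and \<open>(- 2, 3 - 3 (l + s))\<close>, the
    second row gives the eigenvalue \<open>- (2 t + 3 (l + s - 1))\<close>, and the first becomes
    \<open>2 t^2 + (3 (s - 1) + 5 l) t - 2 (l + s) = 0\<close>.\<close>
  define m1 where "m1 = - (2 * ((- (3 * (s - 1) + 5 * l) + d) / 4) + 3 * (l + s - 1))"
  define m2 where "m2 = - (2 * ((- (3 * (s - 1) + 5 * l) - d) / 4) + 3 * (l + s - 1))"
  have d: "d\<^sup>2 = (3 * (s - 1) + 5 * l)\<^sup>2 + 16 * (l + s)" unfolding d_def using assms by simp
  have sum: "m1 + m2 = 2 * l - (3 * s - 3 + 3 * l)" by (simp add: m1_def m2_def field_simps)
  have "m1 = (5 * l + 3 * (s - 1) - 6 * (l + s - 1) - d) / 2" "m2 = (5 * l + 3 * (s - 1) - 6 * (l + s - 1) + d) / 2"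
    by (simp_all add: m1_def m2_def field_simps)
  moreover have "(c - d) / 2 * ((c + d) / 2) = (c\<^sup>2 - d\<^sup>2) / 4" for c :: real
    by (simp add: power2_eq_square algebra_simps)
  ultimately have "m1 * m2 = ((5 * l + 3 * (s - 1) - 6 * (l + s - 1))\<^sup>2 - d\<^sup>2) / 4"
    by (simp only:)
  also have "\<dots> = - 2 * l * (3 * s - 3 + 3 * l) - 4 * (l + s)"
    unfolding d by (simp add: power2_eq_square field_simps)
  finally have prod: "m1 * m2 = - 2 * l * (3 * s - 3 + 3 * l) - 4 * (l + s)" .
  have "complex_of_real m1 + complex_of_real m2 = complex_of_real (2 * l - (3 * s - 3 + 3 * l))"
    "complex_of_real m1 * complex_of_real m2 = complex_of_real (- 2 * l * (3 * s - 3 + 3 * l) - 4 * (l + s))"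
    unfolding sum[symmetric] prod[symmetric] by simp_all
  hence "quad_factor (complex_of_real s) (complex_of_real l) =
      [:complex_of_real m1 * complex_of_real m2, - (complex_of_real m1 + complex_of_real m2), 1:]"
    by (simp add: quad_factor_def algebra_simps)
  also have "\<dots> = [:- complex_of_real m1, 1:] * [:- complex_of_real m2, 1:]" by (simp add: algebra_simps)
  finally show ?thesis unfolding m1_def m2_def .
qed

lemma prod_mset_linear_neq_0: "(\<Prod>a\<in>#L. [:- f a, 1:]) \<noteq> (0 :: 'a :: idom poly)"
  by (auto simp: prod_mset_zero_iff)

lemma proots_prod_mset_linear:
  "proots (\<Prod>a\<in>#L. [:- f a, 1:]) = image_mset f L" for f :: "'b \<Rightarrow> 'a :: idom"
proof (induction L)
  case (add b L)
  have "proots ([:- f b, 1:] * (\<Prod>a\<in>#L. [:- f a, 1:])) = {#f b#} + proots (\<Prod>a\<in>#L. [:- f a, 1:])"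
    by (subst proots_mult[OF _ prod_mset_linear_neq_0]) auto
  thus ?case by (simp only: add image_mset_add_mset prod_mset.add_mset add_mset_add_single[of "f b" "image_mset f L"] add.commute)
qed simp

lemma char_poly_neq_0: "A \<in> carrier_mat n n \<Longrightarrow> char_poly A \<noteq> (0 :: 'a :: comm_ring_1 poly)"
  using degree_monic_char_poly[of A n] by auto

text \<open>A negative multiplicity \<open>q - p\<close> is read as a removal of copies of
  \<open>c\<close> from \<open>R\<close>. For a connected regular graph with \<open>p\<close> at
  least 2, having fewer edges than vertices occurs only for the single edge.\<close>

lemma mset_eq_of_replicate_add:
  assumes "S + replicate_mset p c = replicate_mset q c + R"
  shows "(q \<ge> p \<longrightarrow> S = replicate_mset (q - p) c + R) \<and> (q < p \<longrightarrow> S + replicate_mset (p - q) c = R)"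
proof -
  have count: "count S x + (if x = c then p else 0) = (if x = c then q else 0) + count R x" for x
    using arg_cong[OF assms, of "\<lambda>M. count M x"] by simp
  show ?thesis
  proof (intro conjI impI multiset_eqI)
    fix x
    assume "q \<ge> p"
    thus "count S x = count (replicate_mset (q - p) c + R) x" using count[of x] by (cases "x = c") auto
  next
    fix x
    assume "q < p"
    thus "count (S + replicate_mset (p - q) c) x = count R x" using count[of x] by (cases "x = c") auto
  qed
qed

theorem theorem3p9:
  fixes G\<^sub>1 :: "'a ugraph" and G\<^sub>2 :: "'b ugraph"
    and r\<^sub>1 r\<^sub>2 p\<^sub>1 p\<^sub>2 q\<^sub>1 q\<^sub>2 :: nat
    and lam \<beta> :: "nat \<Rightarrow> real"
    and vs\<^sub>1 :: "'a list" and vs\<^sub>2 :: "'b list" and vs :: "(('a + 'a set) + 'b) list"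
  assumes "simple_graph G\<^sub>1" and "simple_graph G\<^sub>2"
    and "connected_graph G\<^sub>1" and "connected_graph G\<^sub>2"
    and "regular_graph r\<^sub>1 G\<^sub>1" and "regular_graph r\<^sub>2 G\<^sub>2"
    and "card (verts G\<^sub>1) = p\<^sub>1" and "card (verts G\<^sub>2) = p\<^sub>2"
    and "card (edges G\<^sub>1) = q\<^sub>1" and "card (edges G\<^sub>2) = q\<^sub>2"
    and "triangle_free G\<^sub>1"
    and "p\<^sub>1 \<ge> 2"
    and "vertex_order G\<^sub>1 vs\<^sub>1" and "vertex_order G\<^sub>2 vs\<^sub>2"
    and "vertex_order (central_vertex_join G\<^sub>1 G\<^sub>2) vs"
    and "eigenvalues (adjacency_mat G\<^sub>1 vs\<^sub>1) =
           {#complex_of_real (real r\<^sub>1)#} + {#complex_of_real (lam i). i \<in># mset_set {2..p\<^sub>1}#}"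
    and "eigenvalues (adjacency_mat G\<^sub>2 vs\<^sub>2) =
           {#complex_of_real (real r\<^sub>2)#} + {#complex_of_real (\<beta> j). j \<in># mset_set {2..p\<^sub>2}#}"
  shows
    "let t\<^sub>1 = (\<lambda>i. (- (3 * (real r\<^sub>1 - 1) + 5 * lam i)
                  + sqrt ((3 * (real r\<^sub>1 - 1) + 5 * lam i)^2 + 16 * (lam i + real r\<^sub>1))) / 4);
         t\<^sub>2 = (\<lambda>i. (- (3 * (real r\<^sub>1 - 1) + 5 * lam i)
                  - sqrt ((3 * (real r\<^sub>1 - 1) + 5 * lam i)^2 + 16 * (lam i + real r\<^sub>1))) / 4);
         Q = mat_of_rows_list 3
               [[2 * real r\<^sub>1, 2 * (real q\<^sub>1 - real r\<^sub>1), 0],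
                [2 * (real p\<^sub>1 - 2), 3 * (real q\<^sub>1 - 2 * real r\<^sub>1 + 1), 2 * real p\<^sub>2],
                [0, 2 * real q\<^sub>1, 2 * (real p\<^sub>2 - 1 - real r\<^sub>2)]];
         S = eigenvalues (eccentricity_mat (central_vertex_join G\<^sub>1 G\<^sub>2) vs);
         R = {#complex_of_real (- 2 * (1 + \<beta> j)). j \<in># mset_set {2..p\<^sub>2}#}
           + {#complex_of_real (- (2 * t\<^sub>1 i + 3 * (lam i + real r\<^sub>1 - 1))). i \<in># mset_set {2..p\<^sub>1}#}
           + {#complex_of_real (- (2 * t\<^sub>2 i + 3 * (lam i + real r\<^sub>1 - 1))). i \<in># mset_set {2..p\<^sub>1}#}
           + eigenvalues Q
     in (q\<^sub>1 \<ge> p\<^sub>1 \<longrightarrow> S = replicate_mset (q\<^sub>1 - p\<^sub>1) 3 + R)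
      \<and> (q\<^sub>1 < p\<^sub>1 \<longrightarrow> S + replicate_mset (p\<^sub>1 - q\<^sub>1) 3 = R)"
proof -
  note A = assms
  have r_pos: "r\<^sub>1 > 0" using regular_connected_degree_pos[OF A(1,3,5)] A(7,12) by simp
  interpret central_join G\<^sub>1 G\<^sub>2 r\<^sub>1
    using A r_pos by unfold_locales (auto simp: connected_graph_def)
  obtain es where es: "distinct es" "set es = edges G\<^sub>1"
    using finite_distinct_list[OF finite_edges_G] by blast
  have vs1: "distinct vs\<^sub>1" "set vs\<^sub>1 = verts G\<^sub>1" and vs2: "distinct vs\<^sub>2" "set vs\<^sub>2 = verts G\<^sub>2"
    and vs: "distinct vs" "set vs = verts J"
    using A by (auto simp: vertex_order_def)
  have len: "length vs\<^sub>1 = p\<^sub>1" "length vs\<^sub>2 = p\<^sub>2" "length es = q\<^sub>1"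
    using vs1 vs2 es A distinct_card by metis+
  let ?L1 = "mset_set {2..p\<^sub>1}" and ?L2 = "mset_set {2..p\<^sub>2}"
  let ?M = "fmat vs vs (\<lambda>i j. complex_of_real (ecc_entry i j))"
  let ?Q = "fmat [0, 1, 2] [0, 1, 2] (quot p\<^sub>1 q\<^sub>1 p\<^sub>2 r\<^sub>2)"
  let ?x3 = "[:- 3, 1:] :: complex poly"
  define m1 where "m1 = (\<lambda>i. - (2 * ((- (3 * (real r\<^sub>1 - 1) + 5 * lam i)
      + sqrt ((3 * (real r\<^sub>1 - 1) + 5 * lam i)^2 + 16 * (lam i + real r\<^sub>1))) / 4) + 3 * (lam i + real r\<^sub>1 - 1)))"
  define m2 where "m2 = (\<lambda>i. - (2 * ((- (3 * (real r\<^sub>1 - 1) + 5 * lam i)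
      - sqrt ((3 * (real r\<^sub>1 - 1) + 5 * lam i)^2 + 16 * (lam i + real r\<^sub>1))) / 4) + 3 * (lam i + real r\<^sub>1 - 1)))"
  define F where "F = (\<Prod>i\<in>#?L1. [:- complex_of_real (m1 i), 1:]) * (\<Prod>i\<in>#?L1. [:- complex_of_real (m2 i), 1:])"
  define E where "E = (\<Prod>j\<in>#?L2. [:- complex_of_real (- 2 * (1 + \<beta> j)), 1:])"
  have adj1: "proots (char_poly (fmat vs\<^sub>1 vs\<^sub>1 (adj G\<^sub>1))) =
      {#of_nat r\<^sub>1#} + {#complex_of_real (lam i). i \<in># ?L1#}"
    using A(16) by (simp add: eigenvalues_def adjacency_mat_complex)
  have adj2: "proots (char_poly (fmat vs\<^sub>2 vs\<^sub>2 (adj G\<^sub>2))) =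
      {#of_nat r\<^sub>2#} + {#complex_of_real (\<beta> j). j \<in># ?L2#}"
    using A(17) by (simp add: eigenvalues_def adjacency_mat_complex)
  have lam: "lam i \<ge> - real r\<^sub>1" if "i \<in># ?L1" for i
    by (rule adjacency_eigenvalue_ge[OF A(1,5) vs1]) (use that in \<open>auto simp: adj1\<close>)
  have F: "(\<Prod>i\<in>#?L1. quad_factor (of_nat r\<^sub>1) (complex_of_real (lam i))) = F"
  proof -
    have "quad_factor (of_nat r\<^sub>1) (complex_of_real (lam i)) =
        [:- complex_of_real (m1 i), 1:] * [:- complex_of_real (m2 i), 1:]" if "i \<in># ?L1" for i
      using quad_factor_split[OF lam[OF that]] unfolding m1_def m2_def by (simp only: of_real_of_nat_eq)
    hence "(\<Prod>i\<in>#?L1. quad_factor (of_nat r\<^sub>1) (complex_of_real (lam i))) =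
        (\<Prod>i\<in>#?L1. [:- complex_of_real (m1 i), 1:] * [:- complex_of_real (m2 i), 1:])"
      by (intro arg_cong[of _ _ prod_mset] image_mset_cong)
    thus ?thesis by (simp only: F_def prod_mset.distrib)
  qed
  have E: "(\<Prod>j\<in>#?L2. [:2 * (1 + complex_of_real (\<beta> j)), 1:]) = E"
    unfolding E_def by (intro arg_cong[of _ _ prod_mset] image_mset_cong) simp
  have core: "char_poly (fmat vs vs core) * ?x3 ^ p\<^sub>1 =
      ?x3 ^ q\<^sub>1 * (quad_factor (of_nat r\<^sub>1) (of_nat r\<^sub>1) * F) * ([:2 * (1 + of_nat r\<^sub>2), 1:] * E)"
    using char_poly_core[OF vs1 es vs2 vs]
    by (simp only: len adj1 adj2 image_mset_union image_mset_single prod_mset.union prod_mset_singleton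
        image_mset.compositionality o_def F E)
  have quotient: "char_poly (fmat vs vs core) * char_poly ?Q =
      char_poly ?M * (quad_factor (of_nat r\<^sub>1) (of_nat r\<^sub>1) * [:2 * (1 + of_nat r\<^sub>2), 1:])"
    using char_poly_eccentricity_core[OF vs1 es vs2 A(6) vs] by (simp only: len char_poly_reduced)
  \<comment> \<open>\<open>?g\<close> collects the factors of the eigenvalues \<open>r_1\<close> and
    \<open>r_2\<close>, which the lists indexed from 2 leave out. It occurs on both sides and is a
    nonzero polynomial, so cancelling it leaves the quotient matrix in their place.\<close>
  let ?g = "quad_factor (of_nat r\<^sub>1) (of_nat r\<^sub>1) * [:2 * (1 + of_nat r\<^sub>2), 1:] :: complex poly"
  have "?g * (char_poly ?M * ?x3 ^ p\<^sub>1) = (char_poly ?M * ?g) * ?x3 ^ p\<^sub>1"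
    by (simp only: ac_simps)
  also have "\<dots> = (char_poly (fmat vs vs core) * ?x3 ^ p\<^sub>1) * char_poly ?Q"
    unfolding quotient[symmetric] by (simp only: ac_simps)
  also have "\<dots> = ?g * (?x3 ^ q\<^sub>1 * F * E * char_poly ?Q)"
    unfolding core by (simp only: ac_simps)
  finally have eq: "?g * (char_poly ?M * ?x3 ^ p\<^sub>1) = ?g * (?x3 ^ q\<^sub>1 * F * E * char_poly ?Q)" .
  have "?g \<noteq> 0" by (intro no_zero_divisors quad_factor_neq_0) simp
  hence "char_poly ?M * ?x3 ^ p\<^sub>1 = ?x3 ^ q\<^sub>1 * F * E * char_poly ?Q"
    using eq by (rule mult_left_cancel[THEN iffD1])
  hence "proots (char_poly ?M * ?x3 ^ p\<^sub>1) = proots (?x3 ^ q\<^sub>1 * F * E * char_poly ?Q)"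
    by (rule arg_cong)
  moreover have "proots (?x3 ^ k) = replicate_mset k 3" "?x3 ^ k \<noteq> 0" for k
    by (simp_all add: proots_power repeat_mset_replicate_mset)
  moreover have "F \<noteq> 0" "E \<noteq> 0" unfolding F_def E_def by (simp_all only: mult_eq_0_iff prod_mset_linear_neq_0 simp_thms)
  moreover have "char_poly ?M \<noteq> 0" "char_poly ?Q \<noteq> 0" by (rule char_poly_neq_0[OF fmat_carrier])+
  ultimately have "proots (char_poly ?M) + replicate_mset p\<^sub>1 3 =
      replicate_mset q\<^sub>1 3 + proots F + proots E + proots (char_poly ?Q)"
    by (simp only: proots_mult mult_eq_0_iff simp_thms)
  moreover have "proots F = image_mset (\<lambda>i. complex_of_real (m1 i)) ?L1 + image_mset (\<lambda>i. complex_of_real (m2 i)) ?L1"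
    unfolding F_def by (simp only: proots_mult prod_mset_linear_neq_0 proots_prod_mset_linear not_False_eq_True)
  moreover have "proots E = image_mset (\<lambda>j. complex_of_real (- 2 * (1 + \<beta> j))) ?L2"
    unfolding E_def by (rule proots_prod_mset_linear)
  moreover have "eigenvalues (eccentricity_mat J vs) = proots (char_poly ?M)"
  proof -
    have "map_mat complex_of_real (eccentricity_mat J vs) = ?M"
      unfolding eccentricity_mat_J by (rule eq_matI) auto
    thus ?thesis by (simp only: eigenvalues_def)
  qed
  moreover have "eigenvalues (mat_of_rows_list 3
        [[2 * real r\<^sub>1, 2 * (real q\<^sub>1 - real r\<^sub>1), 0],
         [2 * (real p\<^sub>1 - 2), 3 * (real q\<^sub>1 - 2 * real r\<^sub>1 + 1), 2 * real p\<^sub>2],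
         [0, 2 * real q\<^sub>1, 2 * (real p\<^sub>2 - 1 - real r\<^sub>2)]]) = proots (char_poly ?Q)" (is "eigenvalues ?Q' = _")
  proof -
    have "map_mat complex_of_real ?Q' = ?Q"
      by (rule eq_matI) (auto simp: mat_of_rows_list_def quot_def less_Suc_eq numeral_3_eq_3 numeral_2_eq_2)
    thus ?thesis by (simp only: eigenvalues_def)
  qed
  ultimately show ?thesis
    unfolding Let_def m1_def m2_def
    by (intro mset_eq_of_replicate_add) (simp only: ac_simps)
qed

end
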